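(* Let $d\ge 1$ be an integer, let $1\le p\le\infty$, and let $\|\cdot\|$ be the $l^p$-norm on $\mathbb{R}^d$. Let $f$ be a bounded probability density function on $\mathbb{R}^d$, let $X_1,X_2,\dots$ be i.i.d. random vectors in $\mathbb{R}^d$ with density $f$, and let $(r_n)$ be a sequence of positive reals with $r_n\to 0$. Let $G_n=G(\mathcal{X}_n,r_n)$ be the random geometric graph on $\mathcal{X}_n=\{X_1,\dots,X_n\}$. Let $l\ge 1$ be a fixed integer and suppose $nr_n^d\gg\ln n$, i.e. $nr_n^d/\ln n\to\infty$ as $n\to\infty$. Suppose that $f$ satisfies at least one of the following conditions: (a) $f$ is almost everywhere continuous, and $\mathrm{supp} f$ does not contain a sequence of isolated points which has a limit point in $\mathrm{supp} f$; or (b) $f_0>0$. Then $$\frac{\chi_l(G_n)}{l^d\,\chi(G_n)}\longrightarrow 1\qquad\text{almost surely as } n\to\infty.$$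
   Context: The random geometric graph $G(\mathcal{X}_n,r_n)$ has vertex set $\mathcal{X}_n=\{X_1,\dots,X_n\}$, and for $i\ne j$ the vertices $X_i,X_j$ are adjacent if and only if $\|X_i-X_j\|<r_n$. All graphs $G_n$ are built from the same i.i.d. sequence $X_1,X_2,\dots$. For a graph $G$, $\chi(G)$ is the chromatic number and $d_G(u,v)$ is the graph distance (length of a shortest path, $\infty$ if $u,v$ lie in different components). For an integer $l\ge 1$, a distant-$l$ coloring of $G$ is a coloring of the vertices such that any two distinct vertices $u,v$ with $d_G(u,v)\le l$ receive different colors. The distant-$l$ chromatic number $\chi_l(G)$ is the least number of colors in a distant-$l$ coloring of $G$; equivalently $\chi_l(G)=\chi(G^l)$, where $G^l$ has the same vertex set as $G$ and two distinct vertices are adjacent iff their graph distance in $G$ is at most $l$. $\mathrm{supp} f:=\overline{\{x: f(x)>0\}}$ is the support of $f$. $f_0$ is the essential infimum of $f$ over $\mathrm{supp} f$, that is, the largest $h$ such that $P(f(X_1)\ge h)=1$. *)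

theory Defs
  imports "HOL-Probability.Probability" "Graph_Theory.Pair_Digraph" "Graph_Theory.Shortest_Path"
begin

definition lp_norm :: "ereal \<Rightarrow> real ^ 'd \<Rightarrow> real" where
  "lp_norm p x =
     (if p = \<infinity> then infnorm x
      else (\<Sum>i\<in>UNIV. \<bar>x $ i\<bar> powr real_of_ereal p) powr (1 / real_of_ereal p))"

text \<open>
  Undirected simple graphs are finite symmetric loop-free digraphs without parallel arcs,
  i.e. instances of \<^locale>\<open>pair_graph\<close>.
  The infimum over walks in \<open>graph_dist\<close> is the length of a shortest path; it is \<open>\<infinity>\<close> if
  there is none.
\<close>

definition graph_dist :: "'v pair_pre_digraph \<Rightarrow> 'v \<Rightarrow> 'v \<Rightarrow> ereal" where
  "graph_dist G u v = wf_digraph.\<mu> (with_proj G) (\<lambda>_. 1) u v"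

definition proper_coloring :: "'v pair_pre_digraph \<Rightarrow> ('v \<Rightarrow> 'c) \<Rightarrow> bool" where
  "proper_coloring G c \<longleftrightarrow>
     (\<forall>u\<in>pverts G. \<forall>v\<in>pverts G. (u, v) \<in> parcs G \<longrightarrow> c u \<noteq> c v)"

definition chromatic_number :: "'v pair_pre_digraph \<Rightarrow> nat" where
  "chromatic_number G =
     (LEAST k. \<exists>c :: 'v \<Rightarrow> nat. proper_coloring G c \<and> c ` pverts G \<subseteq> {..<k})"

definition distant_coloring :: "nat \<Rightarrow> 'v pair_pre_digraph \<Rightarrow> ('v \<Rightarrow> 'c) \<Rightarrow> bool" where
  "distant_coloring l G c \<longleftrightarrow>
     (\<forall>u\<in>pverts G. \<forall>v\<in>pverts G. u \<noteq> v \<and> graph_dist G u v \<le> ereal (real l) \<longrightarrow> c u \<noteq> c v)"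

definition distant_chromatic_number :: "nat \<Rightarrow> 'v pair_pre_digraph \<Rightarrow> nat" where
  "distant_chromatic_number l G =
     (LEAST k. \<exists>c :: 'v \<Rightarrow> nat. distant_coloring l G c \<and> c ` pverts G \<subseteq> {..<k})"

definition geometric_graph ::
    "ereal \<Rightarrow> (real ^ 'd) set \<Rightarrow> real \<Rightarrow> (real ^ 'd) pair_pre_digraph" where
  "geometric_graph p V \<rho> =
     \<lparr> pverts = V, parcs = {(x, y) \<in> V \<times> V. x \<noteq> y \<and> lp_norm p (x - y) < \<rho>} \<rparr>"

lemma lp_norm_minus_commute: "lp_norm p (x - y) = lp_norm p (y - x)"
  by (simp add: lp_norm_def infnorm_sub abs_minus_commute)

lemma pair_graph_geometric_graph:
  assumes "finite V"
  shows "pair_graph (geometric_graph p V \<rho>)"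
proof
  show "finite (pverts (geometric_graph p V \<rho>))"
    using assms by (simp add: geometric_graph_def)
  show "finite (parcs (geometric_graph p V \<rho>))"
    by (rule finite_subset[of _ "V \<times> V"]) (use assms in \<open>auto simp: geometric_graph_def\<close>)
  show "symmetric (with_proj (geometric_graph p V \<rho>))"
    unfolding symmetric_def
    by (auto simp: geometric_graph_def sym_def lp_norm_minus_commute)
qed (auto simp: geometric_graph_def)

definition support :: "('a :: topological_space \<Rightarrow> real) \<Rightarrow> 'a set" where
  "support f = closure {x. f x > 0}"

text \<open>
  The largest \<open>h\<close> with \<open>P(f(Y) \<ge> h) = 1\<close>, intended for \<open>Y\<close> with density \<open>f\<close>. The maximum is
  attained whenever \<open>f\<close> is measurable and bounded.
\<close>

definition ess_inf_density :: "'w measure \<Rightarrow> ('w \<Rightarrow> 'a) \<Rightarrow> ('a \<Rightarrow> real) \<Rightarrow> real" where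
  "ess_inf_density M Y f = (GREATEST h. measure M {\<omega> \<in> space M. f (Y \<omega>) \<ge> h} = 1)"

end

theory Submission
  imports Defs
begin

text \<open>
  Let \<open>F\<close> be the essential supremum of the density \<open>f\<close>, and let \<open>K\<close> be the largest number of points
  of the cube \<open>[0, L]\<^sup>d\<close> with mutual distances at least \<open>1\<close>. Both chromatic numbers are governed by
  \<open>K\<close> and by the number of sample points in the densest regions.

  Lower bound. A colour class of \<open>G(V, \<rho>)\<close> is a \<open>\<rho>\<close>-separated set, so a cube of side \<open>L \<rho>\<close> meets it in
  at most \<open>K\<close> points. Somewhere there is such a cube in which \<open>f\<close> is close to \<open>F\<close> on almost the whole
  volume, and it contains about \<open>n F (L \<rho>)\<^sup>d\<close> sample points; hence about \<open>(L\<^sup>d / K) n F \<rho>\<^sup>d\<close> colours are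
  necessary. Upper bound. A largest packing of \<open>[0, L]\<^sup>d\<close>, scaled by slightly more than \<open>\<rho>\<close> and repeated
  with period about \<open>(L + 1) \<rho>\<close> in every coordinate, is \<open>\<rho>\<close>-separated. No small cell contains many
  more sample points than \<open>n F\<close> times its volume, and so the translates of this pattern by cells,
  each used repeatedly, give a colouring with about \<open>((L + 1)\<^sup>d / K) n F \<rho>\<^sup>d\<close> colours
  (\<open>chromatic_number_upper\<close>). The two bounds differ by the factor \<open>((L + 1) / L)\<^sup>d\<close>, which is close to
  \<open>1\<close> for large \<open>L\<close>, and \<open>K\<close> cancels.

  For the distant-\<open>l\<close> chromatic number the same bounds hold with \<open>\<rho> = l r\<close>. Graph distance at most
  \<open>l\<close> in \<open>G(V, r)\<close> forces distance less than \<open>l r\<close> in space, so a colouring of \<open>G(V, l r)\<close> is a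
  distant-\<open>l\<close> colouring (\<open>distant_chromatic_number_le\<close>). Conversely, in the dense cube every tiny cell
  contains a sample point, and two points at distance slightly less than \<open>l r\<close> are joined by a path
  of at most \<open>l\<close> edges that follows the segment between them (\<open>graph_dist_le_of_dense\<close>). Hence the
  quotient of \<open>\<chi>\<^sub>l\<close> and \<open>\<chi>\<close> tends to \<open>l\<^sup>d\<close>.

  The counts of sample points are controlled by Chernoff bounds and the Borel-Cantelli lemma. The
  relevant counts are of order \<open>n r\<^sup>d\<close>, which exceeds every multiple of \<open>ln n\<close>, so
  the error probabilities are summable in \<open>n\<close>. The dense cubes come from the regularity of Lebesgue
  measure (\<open>compact_almost_fills_small_cube\<close>).
\<close>

section \<open>The \<open>l\<^sup>p\<close>-norms\<close>

lemma powr_convex_comb: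
  fixes q u v a b :: real
  assumes "1 \<le> q" "0 < u" "0 < v" "u + v = 1" "0 \<le> a" "0 \<le> b"
  shows "(u * a + v * b) powr q \<le> u * a powr q + v * b powr q"
proof -
  have small: "t powr q \<le> t" if "0 < t" "t < 1" for t :: real
    using powr_mono'[of 1 q t] that assms(1) by simp
  have "u < 1" "v < 1" using assms by auto
  consider "a = 0" | "b = 0" | "0 < a" "0 < b" using assms by force
  then show ?thesis
  proof cases
    case 1
    have "(v * b) powr q = v powr q * b powr q" using assms by (simp add: powr_mult)
    also have "\<dots> \<le> v * b powr q" using small[of v] \<open>v < 1\<close> assms by (intro mult_right_mono) auto
    finally show ?thesis using 1 by simp
  next
    case 2
    have "(u * a) powr q = u powr q * a powr q" using assms by (simp add: powr_mult)
    also have "\<dots> \<le> u * a powr q" using small[of u] \<open>u < 1\<close> assms by (intro mult_right_mono) auto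
    finally show ?thesis using 2 by simp
  next
    case 3
    have u: "u = 1 - v" using assms(4) by simp
    show ?thesis unfolding u using convex_onD[OF powr_convex[OF assms(1)], of v a b] 3 assms by auto
  qed
qed

lemma lp_exponent_cases:
  fixes p :: ereal
  assumes "1 \<le> p"
  obtains "p = \<infinity>" | q where "p = ereal q" "1 \<le> q"
  using assms by (cases p) (auto simp: one_ereal_def)

lemma lp_norm_real:
  "lp_norm (ereal q) x = (\<Sum>i\<in>UNIV. \<bar>x $ i\<bar> powr q) powr (1 / q)"
  by (simp add: lp_norm_def)

lemma lp_norm_nonneg: "0 \<le> lp_norm p x"
  by (simp add: lp_norm_def infnorm_pos_le)

lemma component_le_lp_norm:
  fixes x :: "real ^ 'd"
  assumes "1 \<le> p"
  shows "\<bar>x $ i\<bar> \<le> lp_norm p x"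
  using assms
proof (cases p rule: lp_exponent_cases)
  case 1 then show ?thesis by (simp add: lp_norm_def component_le_infnorm_cart)
next
  case (2 q)
  have "\<bar>x $ i\<bar> = (\<bar>x $ i\<bar> powr q) powr (1/q)" using 2 by (simp add: powr_powr)
  also have "\<dots> \<le> (\<Sum>i\<in>UNIV. \<bar>x $ i\<bar> powr q) powr (1/q)"
    using 2 by (intro powr_mono2 member_le_sum) auto
  finally show ?thesis using 2 by (simp add: lp_norm_real)
qed

lemma lp_norm_scaleR:
  fixes x :: "real ^ 'd"
  assumes "1 \<le> p"
  shows "lp_norm p (c *\<^sub>R x) = \<bar>c\<bar> * lp_norm p x"
  using assms
proof (cases p rule: lp_exponent_cases)
  case 1 then show ?thesis by (simp add: lp_norm_def infnorm_mul)
next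
  case (2 q)
  have "(\<Sum>i\<in>UNIV. \<bar>(c *\<^sub>R x) $ i\<bar> powr q) = \<bar>c\<bar> powr q * (\<Sum>i\<in>UNIV. \<bar>x $ i\<bar> powr q)"
    by (simp add: abs_mult powr_mult sum_distrib_left)
  then show ?thesis using 2
    by (simp add: lp_norm_real powr_mult sum_nonneg powr_powr)
qed

lemma lp_norm_0: "1 \<le> p \<Longrightarrow> lp_norm p 0 = 0"
  using lp_norm_scaleR[of p 0 0] by simp

lemma lp_norm_eq_0D:
  fixes x :: "real ^ 'd"
  assumes "1 \<le> p" "lp_norm p x = 0"
  shows "x = 0"
proof -
  have "\<bar>x $ i\<bar> \<le> 0" for i using component_le_lp_norm[OF assms(1), of x i] assms(2) by simp
  then show ?thesis by (simp add: vec_eq_iff)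
qed

text \<open>
  The norms are compared with the maximum norm only; the crude factor is harmless because it enters
  through the diameters of cells that are made arbitrarily small.
\<close>

lemma lp_norm_le:
  fixes x :: "real ^ 'd"
  assumes p: "1 \<le> p" and x: "\<And>i. \<bar>x $ i\<bar> \<le> t"
  shows "lp_norm p x \<le> real CARD('d) * t"
  using p
proof (cases p rule: lp_exponent_cases)
  case 1
  have "infnorm x \<le> t" unfolding infnorm_cart using x by (intro cSup_least) auto
  moreover have "0 \<le> t" using x[of undefined] by linarith
  moreover have "t * 1 \<le> t * real CARD('d)"
    using \<open>0 \<le> t\<close> by (intro mult_left_mono) (auto simp: Suc_leI)
  ultimately show ?thesis using 1 by (simp add: lp_norm_def mult.commute)
next
  case (2 q)
  have t: "0 \<le> t" using x[of undefined] by linarith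
  have "(\<Sum>i\<in>UNIV. \<bar>x $ i\<bar> powr q) \<le> (\<Sum>i\<in>(UNIV::'d set). t powr q)"
    using x 2 by (intro sum_mono powr_mono2) auto
  then have "lp_norm p x \<le> (real CARD('d) * t powr q) powr (1/q)"
    using 2 by (auto simp: lp_norm_real intro!: powr_mono2 sum_nonneg)
  also have "\<dots> = real CARD('d) powr (1/q) * t"
    using 2 t by (simp add: powr_mult powr_powr)
  also have "\<dots> \<le> real CARD('d) powr 1 * t"
    using 2 t by (intro mult_right_mono powr_mono) (auto simp: Suc_leI)
  finally show ?thesis by simp
qed

text \<open>
  Minkowski's inequality in its convexity form: \<open>(x + y) / (A + B)\<close> is the convex combination of the
  unit vectors \<open>x / A\<close> and \<open>y / B\<close> with weights \<open>A / (A + B)\<close> and \<open>B / (A + B)\<close>, and \<open>t powr q\<close> is convex.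
\<close>

lemma lp_norm_triangle:
  fixes x y :: "real ^ 'd"
  assumes p: "1 \<le> p"
  shows "lp_norm p (x + y) \<le> lp_norm p x + lp_norm p y"
  using p
proof (cases p rule: lp_exponent_cases)
  case 1 then show ?thesis by (simp add: lp_norm_def infnorm_triangle)
next
  case (2 q)
  define A where "A = lp_norm p x"
  define B where "B = lp_norm p y"
  have nn: "0 \<le> A" "0 \<le> B" by (simp_all add: A_def B_def lp_norm_nonneg)
  consider "A = 0" | "B = 0" | "0 < A" "0 < B" using nn by force
  then show ?thesis
  proof cases
    case 1
    then show ?thesis using lp_norm_eq_0D[OF p, of x] by (simp add: A_def)
  next
    case 2
    then show ?thesis using lp_norm_eq_0D[OF p, of y] by (simp add: B_def)
  next
    case 3
    define u where "u = A / (A + B)"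
    define v where "v = B / (A + B)"
    have uv: "0 < u" "0 < v" "u + v = 1" using 3 by (auto simp: u_def v_def add_divide_distrib[symmetric])
    have unit: "(\<Sum>i\<in>UNIV. (\<bar>z $ i\<bar> / lp_norm p z) powr q) = 1"
      if "0 < lp_norm p z" for z :: "real ^ 'd"
    proof -
      have "(\<Sum>i\<in>UNIV. (\<bar>z $ i\<bar> / lp_norm p z) powr q)
          = (\<Sum>i\<in>UNIV. \<bar>z $ i\<bar> powr q) / lp_norm p z powr q"
        using that by (simp add: powr_divide sum_divide_distrib)
      also have "lp_norm p z powr q = (\<Sum>i\<in>UNIV. \<bar>z $ i\<bar> powr q)"
        using 2 that by (auto simp: lp_norm_real powr_powr sum_nonneg)
      finally show ?thesis using that 2 by (auto simp: lp_norm_real)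
    qed
    have "(\<Sum>i\<in>UNIV. \<bar>(x + y) $ i\<bar> powr q)
        \<le> (\<Sum>i\<in>UNIV. (A + B) powr q * (u * (\<bar>x $ i\<bar> / A) powr q + v * (\<bar>y $ i\<bar> / B) powr q))"
    proof (rule sum_mono)
      fix i
      have eq: "(A + B) * (u * (\<bar>x $ i\<bar> / A) + v * (\<bar>y $ i\<bar> / B)) = \<bar>x $ i\<bar> + \<bar>y $ i\<bar>"
      proof -
        have "(A + B) * u = A" "(A + B) * v = B" using 3 by (simp_all add: u_def v_def)
        then show ?thesis using 3 by (simp add: distrib_left flip: mult.assoc)
      qed
      have "\<bar>(x + y) $ i\<bar> powr q \<le> ((A + B) * (u * (\<bar>x $ i\<bar> / A) + v * (\<bar>y $ i\<bar> / B))) powr q"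
        unfolding eq using 2 by (intro powr_mono2) auto
      also have "\<dots> = (A + B) powr q * (u * (\<bar>x $ i\<bar> / A) + v * (\<bar>y $ i\<bar> / B)) powr q"
        using 3 uv by (simp add: powr_mult)
      also have "\<dots> \<le> (A + B) powr q * (u * (\<bar>x $ i\<bar> / A) powr q + v * (\<bar>y $ i\<bar> / B) powr q)"
        using 2 3 uv by (intro mult_left_mono powr_convex_comb) auto
      finally show "\<bar>(x + y) $ i\<bar> powr q \<le> \<dots>" .
    qed
    also have "\<dots> = (A + B) powr q"
      using unit[of x] unit[of y] 3 uv
      by (simp add: sum_distrib_left[symmetric] sum.distrib A_def[symmetric] B_def[symmetric])
    finally have "(\<Sum>i\<in>UNIV. \<bar>(x + y) $ i\<bar> powr q) powr (1/q) \<le> ((A + B) powr q) powr (1/q)"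
      using 2 by (intro powr_mono2) (auto intro!: sum_nonneg)
    then show ?thesis using 2 3 by (simp add: lp_norm_real powr_powr A_def B_def)
  qed
qed

lemma lp_norm_triangle_sub:
  fixes x y z :: "real ^ 'd"
  assumes p: "1 \<le> p"
  shows "lp_norm p (x - z) \<le> lp_norm p (x - y) + lp_norm p (y - z)"
  using lp_norm_triangle[OF p, of "x - y" "y - z"] by simp

section \<open>Colourings and graph distance of geometric graphs\<close>

lemma pverts_geometric_graph [simp]: "pverts (geometric_graph p V \<rho>) = V"
  by (simp add: geometric_graph_def)

lemma parcs_geometric_graph:
  "(x, y) \<in> parcs (geometric_graph p V \<rho>) \<longleftrightarrow> x \<in> V \<and> y \<in> V \<and> x \<noteq> y \<and> lp_norm p (x - y) < \<rho>"
  by (simp add: geometric_graph_def)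

lemma wf_digraph_geometric_graph: "wf_digraph (with_proj (geometric_graph p V \<rho>))"
  by unfold_locales (auto simp: geometric_graph_def)

lemma finite_card_injection_nat:
  assumes "finite S"
  obtains h :: "'a \<Rightarrow> nat" where "inj_on h S" "h ` S \<subseteq> {..<card S}"
  using ex_bij_betw_finite_nat[OF assms] by (metis bij_betw_def lessThan_atLeast0 order_refl)

text \<open>
  Colours may be taken from any finite set, which lets the periodic colouring below use pairs and
  integer vectors.
\<close>

lemma chromatic_number_le_card:
  assumes "proper_coloring G c" "c ` pverts G \<subseteq> S" "finite S"
  shows "chromatic_number G \<le> card S"
proof -
  obtain h :: "'b \<Rightarrow> nat" where h: "inj_on h S" "h ` S \<subseteq> {..<card S}"
    using finite_card_injection_nat[OF assms(3)] .
  have "proper_coloring G (h \<circ> c)"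
    using assms h(1) unfolding proper_coloring_def by (auto dest!: inj_onD)
  moreover have "(h \<circ> c) ` pverts G \<subseteq> {..<card S}" using assms h by auto
  ultimately show ?thesis unfolding chromatic_number_def by (intro Least_le) blast
qed

lemma chromatic_number_attained:
  fixes G :: "'v pair_pre_digraph"
  assumes "finite (pverts G)" "\<And>u. (u, u) \<notin> parcs G"
  obtains c :: "'v \<Rightarrow> nat" where "proper_coloring G c" "c ` pverts G \<subseteq> {..<chromatic_number G}"
proof -
  obtain h :: "'v \<Rightarrow> nat" where h: "inj_on h (pverts G)" "h ` pverts G \<subseteq> {..<card (pverts G)}"
    using finite_card_injection_nat[OF assms(1)] .
  have "proper_coloring G h"
    using assms h(1) unfolding proper_coloring_def by (auto dest!: inj_onD)
  with h(2) have "\<exists>k. \<exists>c :: 'v \<Rightarrow> nat. proper_coloring G c \<and> c ` pverts G \<subseteq> {..<k}" by blast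
  from LeastI_ex[OF this] that show ?thesis unfolding chromatic_number_def by blast
qed

lemma distant_chromatic_number_attained:
  fixes G :: "'v pair_pre_digraph"
  assumes "finite (pverts G)"
  obtains c :: "'v \<Rightarrow> nat" where "distant_coloring l G c"
    "c ` pverts G \<subseteq> {..<distant_chromatic_number l G}"
proof -
  obtain h :: "'v \<Rightarrow> nat" where h: "inj_on h (pverts G)" "h ` pverts G \<subseteq> {..<card (pverts G)}"
    using finite_card_injection_nat[OF assms(1)] .
  have "distant_coloring l G h"
    using assms h(1) unfolding distant_coloring_def by (auto dest!: inj_onD)
  with h(2) have "\<exists>k. \<exists>c :: 'v \<Rightarrow> nat. distant_coloring l G c \<and> c ` pverts G \<subseteq> {..<k}" by blast
  from LeastI_ex[OF this] that show ?thesis unfolding distant_chromatic_number_def by blast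
qed

lemma graph_dist_le_iff:
  assumes "wf_digraph (with_proj G)"
  shows "graph_dist G u v \<le> ereal (real k)
     \<longleftrightarrow> (\<exists>w. pre_digraph.awalk (with_proj G) u w v \<and> length w \<le> k)"
proof -
  interpret wf_digraph "with_proj G" by fact
  have cost: "awalk_cost (\<lambda>_. 1) w = real (length w)" for w :: "('a \<times> 'a) list"
    by (induction w) auto
  show ?thesis
  proof
    assume le: "graph_dist G u v \<le> ereal (real k)"
    show "\<exists>w. awalk u w v \<and> length w \<le> k"
    proof (rule ccontr)
      assume "\<not> ?thesis"
      then have "ereal (real (Suc k)) \<le> ereal (real (length w))" if "awalk u w v" for w
        using that by (metis Suc_leI ereal_less_eq(3) not_le of_nat_le_iff)
      then have "ereal (real (Suc k)) \<le> \<mu> (\<lambda>_. 1) u v"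
        unfolding \<mu>_def by (intro INF_greatest) (simp add: cost)
      with le have "ereal (real (Suc k)) \<le> ereal (real k)"
        unfolding graph_dist_def by (metis order_trans)
      then show False by simp
    qed
  next
    assume "\<exists>w. awalk u w v \<and> length w \<le> k"
    then obtain w where w: "awalk u w v" "length w \<le> k" by blast
    have "\<mu> (\<lambda>_. 1) u v \<le> ereal (real (length w))"
      using min_cost_le_walk_cost[OF w(1), of "\<lambda>_. 1"] by (simp add: cost)
    also have "\<dots> \<le> ereal (real k)" using w by simp
    finally show "graph_dist G u v \<le> ereal (real k)" unfolding graph_dist_def .
  qed
qed

lemma lp_norm_le_walk_length:
  fixes V :: "(real ^ 'd) set"
  assumes p: "1 \<le> p"
    and w: "pre_digraph.awalk (with_proj (geometric_graph p V \<rho>)) u w v"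
  shows "lp_norm p (u - v) \<le> real (length w) * \<rho> \<and> (w \<noteq> [] \<longrightarrow> lp_norm p (u - v) < real (length w) * \<rho>)"
proof -
  interpret wf_digraph "with_proj (geometric_graph p V \<rho>)" by (rule wf_digraph_geometric_graph)
  show ?thesis using w
  proof (induction w arbitrary: u)
    case Nil
    then have "u = v" by (simp add: awalk_Nil_iff)
    then show ?case using lp_norm_0[OF p, where 'a='d] by simp
  next
    case (Cons e w)
    from Cons.prems have e: "e \<in> parcs (geometric_graph p V \<rho>)" "fst e = u" and w: "awalk (snd e) w v"
      by (auto simp: awalk_Cons_iff)
    from e have "lp_norm p (u - snd e) < \<rho>"
      by (cases e) (auto simp: parcs_geometric_graph)
    with Cons.IH[OF w] lp_norm_triangle_sub[OF p, of u v "snd e"]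
    show ?case by (auto simp: algebra_simps)
  qed
qed

text \<open>
  Consecutive points of the chain may coincide, in which case the walk simply skips a step; the
  approximation of a segment by sample points produces such repetitions.
\<close>

lemma graph_dist_chain:
  fixes V :: "(real ^ 'd) set"
  assumes "\<And>j. j \<le> k \<Longrightarrow> z j \<in> V" "\<And>j. j < k \<Longrightarrow> lp_norm p (z j - z (Suc j)) < \<rho>"
  shows "graph_dist (geometric_graph p V \<rho>) (z 0) (z k) \<le> ereal (real k)"
proof -
  interpret wf_digraph "with_proj (geometric_graph p V \<rho>)" by (rule wf_digraph_geometric_graph)
  have "\<exists>w. awalk (z 0) w (z k) \<and> length w \<le> k" using assms
  proof (induction k)
    case 0 then show ?case by (intro exI[of _ "[]"]) (auto simp: awalk_Nil_iff)
  next
    case (Suc k)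
    then obtain w where w: "awalk (z 0) w (z k)" "length w \<le> k" by force
    show ?case
    proof (cases "z k = z (Suc k)")
      case True then show ?thesis using w by (metis le_SucI)
    next
      case False
      then have "awalk (z k) [(z k, z (Suc k))] (z (Suc k))"
        using Suc.prems by (auto simp: awalk_Cons_iff awalk_Nil_iff parcs_geometric_graph)
      with w show ?thesis by (intro exI[of _ "w @ [(z k, z (Suc k))]"]) (auto simp: awalk_append_iff)
    qed
  qed
  then show ?thesis by (simp add: graph_dist_le_iff[OF wf_digraph_geometric_graph])
qed

text \<open>
  By the triangle inequality, points at graph distance at most \<open>l\<close> are at distance less than \<open>l \<rho>\<close>,
  hence adjacent in \<open>G(V, l \<rho>)\<close>.
\<close>

lemma distant_chromatic_number_le:
  fixes V :: "(real ^ 'd) set"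
  assumes p: "1 \<le> p" and V: "finite V" and \<rho>: "0 < \<rho>"
  shows "distant_chromatic_number l (geometric_graph p V \<rho>)
     \<le> chromatic_number (geometric_graph p V (real l * \<rho>))"
proof -
  obtain c :: "real ^ 'd \<Rightarrow> nat" where c: "proper_coloring (geometric_graph p V (real l * \<rho>)) c"
    "c ` V \<subseteq> {..<chromatic_number (geometric_graph p V (real l * \<rho>))}"
    using chromatic_number_attained[of "geometric_graph p V (real l * \<rho>)"] V
    by (auto simp: parcs_geometric_graph)
  have "distant_coloring l (geometric_graph p V \<rho>) c"
    unfolding distant_coloring_def
  proof (intro ballI impI)
    fix u v assume uv: "u \<in> pverts (geometric_graph p V \<rho>)" "v \<in> pverts (geometric_graph p V \<rho>)"
      "u \<noteq> v \<and> graph_dist (geometric_graph p V \<rho>) u v \<le> ereal (real l)"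
    then obtain w where w: "pre_digraph.awalk (with_proj (geometric_graph p V \<rho>)) u w v" "length w \<le> l"
      by (auto simp: graph_dist_le_iff[OF wf_digraph_geometric_graph])
    have "w \<noteq> []" using w(1) uv by (auto simp: pre_digraph.awalk_def pre_digraph.cas.simps)
    then have "lp_norm p (u - v) < real (length w) * \<rho>" using lp_norm_le_walk_length[OF p w(1)] by blast
    also have "\<dots> \<le> real l * \<rho>" using w \<rho> by simp
    finally have "(u, v) \<in> parcs (geometric_graph p V (real l * \<rho>))"
      using uv by (simp add: parcs_geometric_graph)
    then show "c u \<noteq> c v" using c(1) uv unfolding proper_coloring_def by simp
  qed
  then show ?thesis using c(2) unfolding distant_chromatic_number_def
    by (intro Least_le) auto
qed

section \<open>Colouring by translates of a periodic packing\<close>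

text \<open>
  The half-open cells of the grid of mesh \<open>s\<close>. They partition the space, and the cells of mesh \<open>T s\<close>
  are unions of cells of mesh \<open>s\<close>, so the same notion serves for the large cubes and for their
  subdivision.
\<close>

definition cube :: "real \<Rightarrow> ('d \<Rightarrow> int) \<Rightarrow> (real ^ 'd) set" where
  "cube s z = {x. \<forall>i. \<lfloor>x $ i / s\<rfloor> = z i}"

definition packing :: "ereal \<Rightarrow> nat \<Rightarrow> (real ^ 'd) set \<Rightarrow> bool" where
  "packing p L A \<longleftrightarrow> finite A \<and> (\<forall>a\<in>A. \<forall>i. 0 \<le> a $ i \<and> a $ i \<le> real L) \<and>
     (\<forall>a\<in>A. \<forall>b\<in>A. a \<noteq> b \<longrightarrow> 1 \<le> lp_norm p (a - b))"

lemma mem_cube_iff: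
  assumes "0 < s"
  shows "x \<in> cube s z \<longleftrightarrow> (\<forall>i. real_of_int (z i) * s \<le> x $ i \<and> x $ i < (real_of_int (z i) + 1) * s)"
  using assms unfolding cube_def floor_eq_iff by (simp add: field_simps)

lemma mem_cube_floor: "x \<in> cube s (\<lambda>i. \<lfloor>x $ i / s\<rfloor>)"
  by (simp add: cube_def)

text \<open>
  Two points in the same cell of mesh \<open>1 / (d + 1)\<close> are closer than \<open>1\<close>, so a packing has at most
  one point per cell.
\<close>

lemma packing_card_bounded:
  assumes p: "1 \<le> p"
  shows "\<exists>N. \<forall>A :: (real ^ 'd) set. packing p L A \<longrightarrow> card A \<le> N"
proof -
  define T where "T = real (CARD('d) + 1)"
  define Z where "Z = (PiE UNIV (\<lambda>_. {0..\<lfloor>T * real L\<rfloor>}) :: ('d \<Rightarrow> int) set)"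
  have T: "0 < T" by (simp add: T_def)
  have Z: "finite Z" unfolding Z_def by (intro finite_PiE) auto
  have "card A \<le> card Z" if A: "packing p L A" for A :: "(real ^ 'd) set"
  proof (rule card_inj_on_le[OF _ _ Z])
    let ?g = "\<lambda>a::real ^ 'd. \<lambda>i. \<lfloor>T * a $ i\<rfloor>"
    show "?g ` A \<subseteq> Z"
      using A T by (auto simp: Z_def packing_def intro!: floor_mono mult_left_mono)
    show "inj_on ?g A"
    proof (rule inj_onI, rule ccontr)
      fix a b assume ab: "a \<in> A" "b \<in> A" "?g a = ?g b" "a \<noteq> b"
      have "\<bar>(a - b) $ i\<bar> \<le> 1 / T" for i
      proof -
        have "\<lfloor>T * a $ i\<rfloor> = \<lfloor>T * b $ i\<rfloor>" using fun_cong[OF ab(3), of i] .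
        then have "\<bar>T * a $ i - T * b $ i\<bar> < 1" by linarith
        then have "T * \<bar>(a - b) $ i\<bar> < 1" using T
          by (simp add: right_diff_distrib[symmetric] abs_mult)
        then show ?thesis using T by (simp add: field_simps)
      qed
      from lp_norm_le[OF p this] have "lp_norm p (a - b) \<le> real CARD('d) / T" by simp
      also have "\<dots> < 1" using T by (simp add: T_def)
      finally show False using A ab unfolding packing_def by force
    qed
  qed
  then show ?thesis by blast
qed

lemma packing_maximum:
  assumes p: "1 \<le> p"
  obtains A :: "(real ^ 'd) set" where "packing p L A" "0 < card A"
    "\<And>B :: (real ^ 'd) set. packing p L B \<Longrightarrow> card B \<le> card A"
proof -
  obtain N where N: "\<And>A :: (real ^ 'd) set. packing p L A \<Longrightarrow> card A \<le> N"
    using packing_card_bounded[OF p] by blast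
  have 0: "packing p L {0 :: real ^ 'd}" by (simp add: packing_def)
  obtain A :: "(real ^ 'd) set" where A: "packing p L A" "\<And>B :: (real ^ 'd) set. packing p L B \<Longrightarrow> card B \<le> card A"
    using ex_has_greatest_nat[of "packing p L" "{0 :: real ^ 'd}" card "Suc N"] 0 N by (metis less_Suc_eq_le)
  show thesis using that[OF A(1) _ A(2)] A(2)[OF 0] by simp
qed

lemma lp_norm_floor_diff_ge:
  fixes a b :: "real ^ 'd"
  assumes p: "1 \<le> p"
  shows "lp_norm p (\<chi> i. real_of_int (\<lfloor>a $ i\<rfloor> - \<lfloor>b $ i\<rfloor>)) \<ge> lp_norm p (a - b) - real CARD('d)"
proof -
  let ?y = "(\<chi> i. real_of_int (\<lfloor>a $ i\<rfloor> - \<lfloor>b $ i\<rfloor>)) :: real ^ 'd"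
  have "\<bar>((a - b) - ?y) $ i\<bar> \<le> 1" for i by simp linarith
  from lp_norm_le[OF p this] have "lp_norm p ((a - b) - ?y) \<le> real CARD('d)" by simp
  moreover have "lp_norm p (a - b) \<le> lp_norm p ((a - b) - ?y) + lp_norm p ?y"
    using lp_norm_triangle[OF p, of "(a - b) - ?y" ?y] by simp
  ultimately show ?thesis by simp
qed

lemma dvd_small_int:
  fixes P m :: int
  assumes "P dvd m" "\<bar>m\<bar> < P" shows "m = 0"
proof (rule ccontr)
  assume "m \<noteq> 0"
  from dvd_imp_le_int[OF this assms(1)] assms(2) show False by linarith
qed

text \<open>
  The space is cut into cells of side \<open>\<rho> / D\<close>, and \<open>W\<close> is \<open>D\<close> enlarged by a safety margin for two
  roundings to cells. The packing \<open>A\<close>, scaled by \<open>W\<close> and rounded, is a set \<open>I\<close> of cells which, repeated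
  with period \<open>P\<close>, is far apart. The points of each cell are numbered, and number \<open>j = q \<bar>A\<bar> + i\<close> is
  paired with the \<open>i\<close>-th cell of the pattern: the point receives the round \<open>q\<close> together with the
  translation, modulo \<open>P\<close>, that moves \<open>I\<^sub>i\<close> to its cell. Points of one colour then lie in different
  cells of one translate of the periodic pattern.
\<close>

lemma chromatic_number_upper:
  fixes V A :: "(real ^ 'd) set" and \<rho> :: real and D L m :: nat
  defines "W \<equiv> real D + 2 * real CARD('d)"
  assumes p: "1 \<le> p" and V: "finite V" and \<rho>: "0 < \<rho>" and D: "0 < D"
    and A: "packing p L A" "0 < card A"
    and m: "\<And>z. card (V \<inter> cube (\<rho> / real D) z) \<le> m"
  shows "chromatic_number (geometric_graph p V \<rho>)
     \<le> (m div card A + 1) * nat \<lceil>(real L + 1) * W\<rceil> ^ CARD('d)"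
proof -
  define s where "s = \<rho> / real D"
  define k where "k = card A"
  define P where "P = nat \<lceil>(real L + 1) * W\<rceil>"
  define C where "C = real CARD('d)"
  have s: "0 < s" using \<rho> D by (simp add: s_def)
  have k: "0 < k" using A by (simp add: k_def)
  have W: "0 < W" "W = real D + 2 * C" using D by (simp_all add: W_def C_def add_pos_nonneg)
  have P: "(real L + 1) * W \<le> real P" unfolding P_def by linarith
  have Ppos: "0 < P" using P W by (smt (verit) mult_pos_pos of_nat_0_le_iff of_nat_0_less_iff)
  define cell :: "real ^ 'd \<Rightarrow> 'd \<Rightarrow> int" where "cell v = (\<lambda>i. \<lfloor>v $ i / s\<rfloor>)" for v
  have "\<exists>h. inj_on h (V \<inter> cube s z) \<and> h ` (V \<inter> cube s z) \<subseteq> {..<m}" for z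
  proof -
    obtain h :: "real ^ 'd \<Rightarrow> nat" where "inj_on h (V \<inter> cube s z)"
      "h ` (V \<inter> cube s z) \<subseteq> {..<card (V \<inter> cube s z)}"
      using finite_card_injection_nat[of "V \<inter> cube s z"] V by blast
    then show ?thesis using m[of z] unfolding s_def by (intro exI[of _ h]) auto
  qed
  then obtain h where h: "\<And>z. inj_on (h z) (V \<inter> cube s z)" "\<And>z. h z ` (V \<inter> cube s z) \<subseteq> {..<m}"
    by metis
  define idx where "idx v = h (cell v) v" for v
  have incube: "v \<in> cube s (cell v)" for v unfolding cell_def by (rule mem_cube_floor)
  have idx: "idx v < m" if "v \<in> V" for v
    using h(2)[of "cell v"] that incube[of v] unfolding idx_def by auto
  have idx_inj: "u = v" if "u \<in> V" "v \<in> V" "cell u = cell v" "idx u = idx v" for u v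
    using h(1)[of "cell v"] that incube[of v] incube[of u] unfolding idx_def by (auto dest: inj_onD)
  obtain a where a: "bij_betw a {..<k} A"
    using ex_bij_betw_nat_finite[of A] A(1) by (auto simp: packing_def k_def atLeast0LessThan)
  define I :: "nat \<Rightarrow> 'd \<Rightarrow> int" where "I j = (\<lambda>i. \<lfloor>W * a j $ i\<rfloor>)" for j
  define S where "S = {..<m div k + 1} \<times> (PiE UNIV (\<lambda>_. {0..<int P}) :: ('d \<Rightarrow> int) set)"
  define c where "c v = (idx v div k, \<lambda>i. (cell v i - I (idx v mod k) i) mod int P)" for v
  have cS: "c ` V \<subseteq> S"
  proof
    fix x assume "x \<in> c ` V"
    then obtain v where v: "v \<in> V" "x = c v" by blast
    have "idx v div k \<le> m div k" using idx[OF v(1)] by (intro div_le_mono) simp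
    then show "x \<in> S" using Ppos v(2) unfolding c_def S_def by (simp add: PiE_def extensional_def)
  qed
  have cardS: "card S = (m div k + 1) * P ^ CARD('d)"
    by (simp add: S_def card_cartesian_product card_PiE)
  have finS: "finite S" unfolding S_def by (intro finite_cartesian_product finite_PiE) auto
  have amem: "a j \<in> A" if "j < k" for j using a that by (auto simp: bij_betw_def)
  have ainj: "i = j" if "i < k" "j < k" "a i = a j" for i j
    using a that by (auto simp: bij_betw_def inj_on_def)
  have arange: "0 \<le> a j $ i" "a j $ i \<le> real L" if "j < k" for j i
    using amem[OF that] A(1) unfolding packing_def by auto
  have Irange: "0 \<le> I j i" "real_of_int (I j i) \<le> real L * W" if "j < k" for j i
  proof -
    show "0 \<le> I j i" using arange(1)[OF that, of i] W by (simp add: I_def)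
    have "real_of_int (I j i) \<le> W * a j $ i" by (simp add: I_def)
    also have "\<dots> \<le> W * real L" using arange(2)[OF that, of i] W by simp
    finally show "real_of_int (I j i) \<le> real L * W" by (simp add: mult.commute)
  qed
  \<comment> \<open>The periodic pattern has gaps of at least \<open>D + C\<close>: within one period by the packing
    property, and between different periods by the margin left by \<open>P\<close>.\<close>
  have far: "real D + C \<le> lp_norm p (\<chi> i. real_of_int (cell u i - cell v i))"
    if uv: "u \<in> V" "v \<in> V" "u \<noteq> v" "c u = c v" for u v
  proof -
    define j where "j = idx u mod k"
    define j' where "j' = idx v mod k"
    have jk: "j < k" "j' < k" using k by (simp_all add: j_def j'_def)
    have "idx u div k = idx v div k" using uv(4) by (simp add: c_def)
    then have jeq: "idx u = idx v" if "j = j'" using that unfolding j_def j'_def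
      by (metis div_mult_mod_eq)
    have "(\<lambda>i. (cell u i - I j i) mod int P) = (\<lambda>i. (cell v i - I j' i) mod int P)"
      using uv(4) by (simp add: c_def j_def j'_def)
    then have "(cell u i - I j i) mod int P = (cell v i - I j' i) mod int P" for i
      by (rule fun_cong)
    then have dvd: "int P dvd (cell u i - I j i) - (cell v i - I j' i)" for i
      by (simp add: mod_eq_dvd_iff)
    show ?thesis
    proof (cases "\<forall>i. (cell u i - I j i) - (cell v i - I j' i) = 0")
      case True
      then have eq: "cell u i - cell v i = I j i - I j' i" for i by (simp add: algebra_simps)
      have "j \<noteq> j'"
      proof
        assume "j = j'"
        then have "cell u = cell v" using eq by (auto simp: fun_eq_iff)
        then show False using idx_inj[OF uv(1,2)] jeq[OF \<open>j = j'\<close>] uv(3) by blast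
      qed
      then have "1 \<le> lp_norm p (a j - a j')"
        using A(1) amem jk ainj unfolding packing_def by metis
      then have "W * 1 \<le> W * lp_norm p (a j - a j')" using W by (intro mult_left_mono) auto
      also have "\<dots> = lp_norm p (W *\<^sub>R a j - W *\<^sub>R a j')"
        using lp_norm_scaleR[OF p, of W "a j - a j'"] W by (simp add: scaleR_diff_right)
      also have "\<dots> - C \<le> lp_norm p (\<chi> i. real_of_int (I j i - I j' i))"
        using lp_norm_floor_diff_ge[OF p, of "W *\<^sub>R a j" "W *\<^sub>R a j'"] by (simp add: I_def C_def)
      finally show ?thesis using W by (simp add: eq)
    next
      case False
      then obtain i where i: "(cell u i - I j i) - (cell v i - I j' i) \<noteq> 0" by blast
      then have "int P \<le> \<bar>(cell u i - I j i) - (cell v i - I j' i)\<bar>"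
        using dvd_small_int[OF dvd[of i]] by (metis not_less)
      then have "real P \<le> \<bar>real_of_int (cell u i - cell v i)\<bar> + \<bar>real_of_int (I j i) - real_of_int (I j' i)\<bar>"
        by linarith
      moreover have "\<bar>real_of_int (I j i) - real_of_int (I j' i)\<bar> \<le> real L * W"
        using Irange[OF jk(1), of i] Irange[OF jk(2), of i] by (simp add: abs_le_iff)
      moreover have "\<bar>real_of_int (cell u i - cell v i)\<bar> \<le> lp_norm p (\<chi> i. real_of_int (cell u i - cell v i))"
        using component_le_lp_norm[OF p, of "\<chi> i. real_of_int (cell u i - cell v i)" i] by simp
      moreover have "(real L + 1) * W = real L * W + W" by (simp add: algebra_simps)
      ultimately show ?thesis using P W by (simp add: C_def)
    qed
  qed
  have "proper_coloring (geometric_graph p V \<rho>) c"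
    unfolding proper_coloring_def
  proof (intro ballI impI notI)
    fix u v assume uv: "u \<in> pverts (geometric_graph p V \<rho>)" "v \<in> pverts (geometric_graph p V \<rho>)"
      "(u, v) \<in> parcs (geometric_graph p V \<rho>)" "c u = c v"
    then have uv': "u \<in> V" "v \<in> V" "u \<noteq> v" "lp_norm p (u - v) < \<rho>" by (auto simp: parcs_geometric_graph)
    let ?x = "(\<chi> i. u $ i / s) :: real ^ 'd" and ?y = "(\<chi> i. v $ i / s) :: real ^ 'd"
    let ?z = "(\<chi> i. real_of_int (cell u i - cell v i)) :: real ^ 'd"
    have "\<bar>(?z - (?x - ?y)) $ i\<bar> \<le> 1" for i unfolding cell_def by simp linarith
    from lp_norm_le[OF p this] have "lp_norm p (?z - (?x - ?y)) \<le> C" by (simp add: C_def)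
    moreover have "lp_norm p ?z \<le> lp_norm p (?z - (?x - ?y)) + lp_norm p (?x - ?y)"
      using lp_norm_triangle[OF p, of "?z - (?x - ?y)" "?x - ?y"] by simp
    ultimately have "real D \<le> lp_norm p (?x - ?y)" using far[OF uv'(1-3) uv(4)] by linarith
    moreover have "?x - ?y = (1 / s) *\<^sub>R (u - v)" by (simp add: vec_eq_iff diff_divide_distrib)
    ultimately have "real D \<le> lp_norm p (u - v) / s" using lp_norm_scaleR[OF p, of "1/s" "u - v"] s by simp
    then have "real D * s \<le> lp_norm p (u - v)" using s by (simp add: field_simps)
    then show False using uv'(4) D by (simp add: s_def)
  qed
  from chromatic_number_le_card[OF this _ finS] cS cardS show ?thesis
    unfolding k_def P_def by simp
qed

section \<open>Colour classes in a densely filled cube\<close>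

lemma segment_in_cube:
  assumes s: "0 < s" and uv: "u \<in> cube s z" "v \<in> cube s z" and t: "0 \<le> t" "t \<le> 1"
  shows "u + t *\<^sub>R (v - u) \<in> cube s z"
proof -
  have "real_of_int (z i) * s \<le> (u + t *\<^sub>R (v - u)) $ i \<and>
        (u + t *\<^sub>R (v - u)) $ i < (real_of_int (z i) + 1) * s" for i
  proof -
    have eq: "(u + t *\<^sub>R (v - u)) $ i = (1 - t) * u $ i + t * v $ i" by (simp add: algebra_simps)
    have u: "real_of_int (z i) * s \<le> u $ i" "u $ i < (real_of_int (z i) + 1) * s"
      and v: "real_of_int (z i) * s \<le> v $ i" "v $ i < (real_of_int (z i) + 1) * s"
      using uv s by (auto simp: mem_cube_iff)
    have "(1 - t) * - u $ i + t * - v $ i \<le> - (real_of_int (z i) * s)"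
      using u v t by (intro convex_bound_le) auto
    moreover have "(1 - t) * u $ i + t * v $ i < (real_of_int (z i) + 1) * s"
      using u v t by (intro convex_bound_lt) auto
    ultimately show ?thesis unfolding eq by auto
  qed
  then show ?thesis using s by (simp add: mem_cube_iff)
qed

text \<open>
  The segment from \<open>u\<close> to \<open>v\<close> is cut into \<open>l\<close> pieces of length less than \<open>t / l\<close>, and each cut point
  is moved by at most \<open>\<eta>\<close> to a vertex; the hypothesis on \<open>t\<close> says \<open>t / l + 2 \<eta> \<le> \<rho>\<close>.
\<close>

lemma graph_dist_le_of_dense:
  fixes V :: "(real ^ 'd) set"
  assumes p: "1 \<le> p" and s: "0 < s" and l: "1 \<le> l" and \<eta>: "0 \<le> \<eta>" and t: "t + 2 * real l * \<eta> \<le> real l * \<rho>"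
    and dense: "\<And>y. y \<in> cube s b \<Longrightarrow> \<exists>v\<in>V. lp_norm p (y - v) \<le> \<eta>"
    and u: "u \<in> V \<inter> cube s b" and v: "v \<in> V \<inter> cube s b" and uv: "lp_norm p (u - v) < t"
  shows "graph_dist (geometric_graph p V \<rho>) u v \<le> ereal (real l)"
proof -
  define y where "y j = u + (real j / real l) *\<^sub>R (v - u)" for j
  obtain g where g: "\<And>x. x \<in> cube s b \<Longrightarrow> g x \<in> V \<and> lp_norm p (x - g x) \<le> \<eta>"
    using dense by metis
  define z where "z j = (if j = 0 then u else if j = l then v else g (y j))" for j
  have y0: "y 0 = u" and yl: "y l = v" using l by (auto simp: y_def)
  have ycube: "y j \<in> cube s b" if "j \<le> l" for j
    unfolding y_def using that l u v s by (intro segment_in_cube) auto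
  have near: "z j \<in> V \<and> lp_norm p (y j - z j) \<le> \<eta>" if "j \<le> l" for j
    using g[OF ycube[OF that]] u v \<eta> lp_norm_0[OF p, where 'a='d] y0 yl by (auto simp: z_def)
  have step: "lp_norm p (z j - z (Suc j)) < \<rho>" if j: "j < l" for j
  proof -
    have "y j - y (Suc j) = (1 / real l) *\<^sub>R (u - v)"
      using l by (simp add: y_def vec_eq_iff field_simps)
    then have "lp_norm p (y j - y (Suc j)) = lp_norm p (u - v) / real l"
      using lp_norm_scaleR[OF p, of "1 / real l" "u - v"] by simp
    also have "\<dots> < t / real l" using uv l by (intro divide_strict_right_mono) auto
    also have "\<dots> \<le> \<rho> - 2 * \<eta>" using t l by (simp add: field_simps)
    finally have "lp_norm p (y j - y (Suc j)) < \<rho> - 2 * \<eta>" .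
    moreover have "lp_norm p (z j - z (Suc j))
       \<le> lp_norm p (z j - y j) + lp_norm p (y j - y (Suc j)) + lp_norm p (y (Suc j) - z (Suc j))"
      using lp_norm_triangle_sub[OF p, of "z j" "z (Suc j)" "y j"]
        lp_norm_triangle_sub[OF p, of "y j" "z (Suc j)" "y (Suc j)"] by linarith
    moreover have "lp_norm p (z j - y j) \<le> \<eta>" "lp_norm p (y (Suc j) - z (Suc j)) \<le> \<eta>"
      using near[of j] near[of "Suc j"] j by (auto simp: lp_norm_minus_commute[of p "z j"])
    ultimately show ?thesis by linarith
  qed
  have "graph_dist (geometric_graph p V \<rho>) (z 0) (z l) \<le> ereal (real l)"
    using near step by (intro graph_dist_chain) auto
  then show ?thesis using l by (simp add: z_def)
qed

text \<open>
  A colour class within the cube is \<open>t\<close>-separated, so after rescaling by \<open>1 / t\<close> it is a packing of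
  \<open>[0, L]\<^sup>d\<close>.
\<close>

lemma card_cube_le_distant_chromatic_number:
  fixes V :: "(real ^ 'd) set"
  assumes p: "1 \<le> p" and V: "finite V" and l: "1 \<le> l" and \<eta>: "0 \<le> \<eta>"
    and t: "0 < t" "t + 2 * real l * \<eta> \<le> real l * \<rho>" and L: "1 \<le> L"
    and dense: "\<And>y. y \<in> cube (real L * t) b \<Longrightarrow> \<exists>v\<in>V. lp_norm p (y - v) \<le> \<eta>"
    and K: "\<And>A :: (real ^ 'd) set. packing p L A \<Longrightarrow> card A \<le> K"
  shows "card (V \<inter> cube (real L * t) b) \<le> K * distant_chromatic_number l (geometric_graph p V \<rho>)"
proof -
  let ?Q = "cube (real L * t) b" and ?X = "distant_chromatic_number l (geometric_graph p V \<rho>)"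
  have Lt: "0 < real L * t" using L t by simp
  obtain c :: "real ^ 'd \<Rightarrow> nat" where c: "distant_coloring l (geometric_graph p V \<rho>) c" "c ` V \<subseteq> {..<?X}"
    using distant_chromatic_number_attained[of "geometric_graph p V \<rho>" l] V by auto
  define B where "B q = {v \<in> V \<inter> ?Q. c v = q}" for q
  have card_B: "card (B q) \<le> K" for q
  proof -
    let ?g = "\<lambda>v :: real ^ 'd. \<chi> i. v $ i / t - real_of_int (b i) * real L"
    have inj: "inj_on ?g (B q)" using t by (auto simp: inj_on_def vec_eq_iff)
    have "packing p L (?g ` B q)"
      unfolding packing_def
    proof (intro conjI)
      show "finite (?g ` B q)" using V by (simp add: B_def)
      have "0 \<le> ?g v $ i \<and> ?g v $ i \<le> real L" if "v \<in> B q" for v i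
      proof -
        have "real_of_int (b i) * (real L * t) \<le> v $ i" "v $ i < (real_of_int (b i) + 1) * (real L * t)"
          using that Lt by (auto simp: B_def mem_cube_iff)
        then show ?thesis using t by (simp add: field_simps)
      qed
      then show "\<forall>a\<in>?g ` B q. \<forall>i. 0 \<le> a $ i \<and> a $ i \<le> real L" by blast
      have "1 \<le> lp_norm p (?g u - ?g v)" if "u \<in> B q" "v \<in> B q" "u \<noteq> v" for u v
      proof -
        have mem: "u \<in> V" "v \<in> V" "c u = c v" using that by (simp_all add: B_def)
        have "\<not> graph_dist (geometric_graph p V \<rho>) u v \<le> ereal (real l)"
        proof
          assume "graph_dist (geometric_graph p V \<rho>) u v \<le> ereal (real l)"
          then have "c u \<noteq> c v" using c(1) mem(1,2) that(3) unfolding distant_coloring_def by simp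
          then show False using mem(3) by simp
        qed
        then have "t \<le> lp_norm p (u - v)"
          using graph_dist_le_of_dense[where u = u and v = v, OF p Lt l \<eta> t(2) dense] that
          by (metis (no_types, lifting) B_def mem_Collect_eq not_le)
        moreover have "?g u - ?g v = (1 / t) *\<^sub>R (u - v)" by (simp add: vec_eq_iff diff_divide_distrib)
        ultimately show ?thesis using lp_norm_scaleR[OF p, of "1/t" "u - v"] t by simp
      qed
      then show "\<forall>a\<in>?g ` B q. \<forall>b\<in>?g ` B q. a \<noteq> b \<longrightarrow> 1 \<le> lp_norm p (a - b)" by blast
    qed
    from K[OF this] show ?thesis using inj by (simp add: card_image)
  qed
  have "V \<inter> ?Q = (\<Union>q<?X. B q)" using c(2) by (auto simp: B_def)
  then have "card (V \<inter> ?Q) \<le> (\<Sum>q<?X. card (B q))" by (simp add: card_UN_le)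
  also have "\<dots> \<le> (\<Sum>q<?X. K)" by (intro sum_mono card_B)
  finally show ?thesis by (simp add: mult.commute)
qed

section \<open>Cubes almost filled by a compact set\<close>

lemma sets_cube [measurable]:
  assumes "0 < s"
  shows "cube s z \<in> sets borel"
proof -
  have "cube s z = (\<Inter>i. {x. real_of_int (z i) * s \<le> x $ i} \<inter> {x. x $ i < (real_of_int (z i) + 1) * s})"
    using mem_cube_iff[OF assms] by blast
  moreover have "\<dots> \<in> sets borel"
    by (intro sets.finite_INT sets.Int borel_closed borel_open closed_Collect_le open_Collect_less
        continuous_intros) auto
  ultimately show ?thesis by simp
qed

lemma emeasure_cube:
  fixes z :: "'d::finite \<Rightarrow> int"
  assumes s: "0 < s"
  shows "emeasure lborel (cube s z) = ennreal (s ^ CARD('d))"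
proof -
  define a where "a = ((\<chi> i. real_of_int (z i) * s) :: real ^ 'd)"
  define b where "b = ((\<chi> i. (real_of_int (z i) + 1) * s) :: real ^ 'd)"
  have ab: "a $ i \<le> b $ i" for i using s by (simp add: a_def b_def)
  have "measure lborel (cbox a b) = (\<Prod>i\<in>(UNIV::'d set). s)"
    using ab by (subst content_cbox_cart)
      (auto simp: interval_ne_empty_cart a_def b_def algebra_simps intro!: prod.cong)
  then have c: "emeasure lborel (cbox a b) = ennreal (s ^ CARD('d))"
    using emeasure_lborel_cbox_finite[of a b] by (subst emeasure_eq_ennreal_measure) auto
  have le: "\<And>i. i \<in> Basis \<Longrightarrow> a \<bullet> i \<le> b \<bullet> i"
    using ab by (auto simp: Basis_vec_def inner_axis)
  have b: "emeasure lborel (box a b) = ennreal (s ^ CARD('d))"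
    using c le by (simp add: emeasure_lborel_box emeasure_lborel_cbox)
  have "box a b \<subseteq> cube s z" "cube s z \<subseteq> cbox a b"
    using s by (auto simp: mem_cube_iff mem_box_cart a_def b_def less_imp_le)
  then have "emeasure lborel (box a b) \<le> emeasure lborel (cube s z)"
    "emeasure lborel (cube s z) \<le> emeasure lborel (cbox a b)"
    using s by (auto intro!: emeasure_mono)
  then show ?thesis using b c by simp
qed

lemma measure_cube:
  fixes z :: "'d::finite \<Rightarrow> int"
  assumes s: "0 < s"
  shows "measure lborel (cube s z) = s ^ CARD('d)"
  using emeasure_cube[OF s, of z] s by (simp add: measure_def)

lemma fmeasurable_cube: "0 < s \<Longrightarrow> cube s z \<in> fmeasurable lborel"
  by (intro fmeasurableI) (auto simp: emeasure_cube)

lemma disjoint_family_cube: "disjoint_family_on (cube s) Z"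
  by (auto simp: disjoint_family_on_def cube_def)

lemma cube_component_diff:
  assumes "0 < s" "x \<in> cube s z" "y \<in> cube s z"
  shows "\<bar>(x - y) $ i\<bar> \<le> s"
proof -
  have "real_of_int (z i) * s \<le> x $ i \<and> x $ i < (real_of_int (z i) + 1) * s"
       "real_of_int (z i) * s \<le> y $ i \<and> y $ i < (real_of_int (z i) + 1) * s"
    using assms by (simp_all add: mem_cube_iff)
  moreover have "(real_of_int (z i) + 1) * s = real_of_int (z i) * s + s" by (simp add: algebra_simps)
  ultimately show ?thesis by (simp add: abs_le_iff)
qed

lemma finite_cubes_meeting_bounded:
  fixes K :: "(real ^ 'd) set"
  assumes s: "0 < s" and K: "bounded K"
  shows "finite {z. cube s z \<inter> K \<noteq> {}}"
proof -
  obtain B where B: "\<And>x. x \<in> K \<Longrightarrow> norm x \<le> B" using K by (auto simp: bounded_iff)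
  have "{z. cube s z \<inter> K \<noteq> {}} \<subseteq> (PiE UNIV (\<lambda>_. {\<lfloor>- B / s\<rfloor>..\<lfloor>B / s\<rfloor>}) :: ('d \<Rightarrow> int) set)"
  proof
    fix z assume "z \<in> {z. cube s z \<inter> K \<noteq> {}}"
    then obtain x where x: "x \<in> cube s z" "x \<in> K" by blast
    have "- B \<le> x $ i \<and> x $ i \<le> B" for i
      using B[OF x(2)] component_le_norm_cart[of x i] by linarith
    then have "\<lfloor>- B / s\<rfloor> \<le> \<lfloor>x $ i / s\<rfloor> \<and> \<lfloor>x $ i / s\<rfloor> \<le> \<lfloor>B / s\<rfloor>" for i
      using s by (intro conjI floor_mono divide_right_mono) auto
    then show "z \<in> PiE UNIV (\<lambda>_. {\<lfloor>- B / s\<rfloor>..\<lfloor>B / s\<rfloor>})"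
      using x(1) by (auto simp: cube_def)
  qed
  then show ?thesis by (rule finite_subset) (intro finite_PiE; simp)
qed

text \<open>
  If every grid cube had a
  proportion larger than \<open>\<delta>\<close> outside \<open>K\<close>, the cubes meeting \<open>K\<close> would have total volume at least
  \<open>\<mu>(K) / (1 - \<delta>)\<close>. For a small mesh they all lie inside an open set \<open>U \<supseteq> K\<close> with
  \<open>\<mu>(U) \<le> (1 + \<delta>) \<mu>(K)\<close>, which is a contradiction since \<open>(1 - \<delta>) (1 + \<delta>) < 1\<close>.
\<close>

lemma compact_almost_fills_small_cube:
  fixes K :: "(real ^ 'd) set"
  assumes K: "compact K" "0 < measure lborel K" and \<delta>: "0 < \<delta>" "\<delta> < 1"
  obtains s0 where "0 < s0"
    "\<And>s. 0 < s \<Longrightarrow> s < s0 \<Longrightarrow> \<exists>z. measure lborel (cube s z - K) \<le> \<delta> * s ^ CARD('d)"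
proof -
  let ?\<mu> = "measure lborel :: (real ^ 'd) set \<Rightarrow> real"
  have Kb: "K \<in> sets borel" using K(1) by (simp add: compact_imp_closed)
  have Kf: "K \<in> fmeasurable lborel" using K(1) by (rule fmeasurable_compact)
  obtain U where U: "open U" "K \<subseteq> U" "emeasure lborel (U - K) < ennreal (\<delta> * ?\<mu> K)"
    using outer_regular_lborel[OF Kb, of "\<delta> * ?\<mu> K"] K \<delta> by auto
  have UKf: "U - K \<in> fmeasurable lborel"
    using U Kb by (intro fmeasurableI) (auto intro: less_trans)
  have "?\<mu> (U - K) \<le> \<delta> * ?\<mu> K"
    using U(3) K(2) \<delta> emeasure_eq_measure2[OF UKf] by (simp add: ennreal_less_iff less_imp_le)
  moreover have Ueq: "U = K \<union> (U - K)" using U by blast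
  ultimately have \<mu>U: "?\<mu> U \<le> (1 + \<delta>) * ?\<mu> K"
    using measure_Un_le[of K lborel "U - K"] Kb U(1) by (simp add: algebra_simps)
  have Uf: "U \<in> fmeasurable lborel" using fmeasurable.Un[OF Kf UKf] Ueq by simp
  obtain e where e: "0 < e" "\<And>x y. x \<in> K \<Longrightarrow> dist x y < e \<Longrightarrow> y \<in> U"
  proof -
    obtain e where "e > 0" "(\<Union>x\<in>K. ball x e) \<subseteq> U"
      using compact_subset_open_imp_ball_epsilon_subset[OF K(1) U(1,2)] by blast
    then have "y \<in> U" if "x \<in> K" "dist x y < e" for x y using that by (meson UN_I mem_ball subsetD)
    with \<open>e > 0\<close> show thesis by (rule that)
  qed
  show thesis
  proof (rule that[of "e / real CARD('d)"])
    show "0 < e / real CARD('d)" using e by simp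
    fix s assume s: "0 < s" "s < e / real CARD('d)"
    show "\<exists>z. ?\<mu> (cube s z - K) \<le> \<delta> * s ^ CARD('d)"
    proof (rule ccontr)
      assume "\<not> ?thesis"
      then have big: "\<delta> * s ^ CARD('d) < ?\<mu> (cube s z - K)" for z by (auto simp: not_le)
      define Z where "Z = {z. cube s z \<inter> K \<noteq> {}}"
      have finZ: "finite Z"
        unfolding Z_def by (rule finite_cubes_meeting_bounded[OF s(1) compact_imp_bounded[OF K(1)]])
      have sub: "cube s z \<subseteq> U" if zZ: "z \<in> Z" for z
      proof
        fix y assume y: "y \<in> cube s z"
        obtain x where x: "x \<in> cube s z" "x \<in> K" using zZ by (auto simp: Z_def)
        have "norm (x - y) \<le> (\<Sum>i\<in>UNIV. \<bar>(x - y) $ i\<bar>)" by (rule norm_le_l1_cart)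
        also have "\<dots> \<le> (\<Sum>i\<in>(UNIV::'d set). s)"
          by (intro sum_mono cube_component_diff[OF s(1) x(1) y])
        also have "\<dots> < e" using s by (simp add: field_simps)
        finally show "y \<in> U" using e(2)[OF x(2)] by (simp add: dist_norm)
      qed
      have part: "?\<mu> (cube s z \<inter> K) \<le> (1 - \<delta>) * ?\<mu> (cube s z)" for z
      proof -
        have "?\<mu> (cube s z - K) = ?\<mu> (cube s z) - ?\<mu> (cube s z \<inter> K)"
          using measure_Diff[of lborel "cube s z" "cube s z \<inter> K"] fmeasurable_cube[OF s(1), of z] Kb s
          by (auto simp: Diff_Int emeasure_cube)
        with big[of z] show ?thesis using measure_cube[OF s(1), of z] by (simp add: algebra_simps)
      qed
      have "K = (\<Union>z\<in>Z. cube s z \<inter> K)" using mem_cube_floor unfolding Z_def by blast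
      then have "?\<mu> K \<le> (\<Sum>z\<in>Z. ?\<mu> (cube s z \<inter> K))"
        using measure_UNION_le[OF finZ, of "\<lambda>z. cube s z \<inter> K" lborel] Kb s by simp
      also have "\<dots> \<le> (\<Sum>z\<in>Z. (1 - \<delta>) * ?\<mu> (cube s z))" by (intro sum_mono part)
      also have "\<dots> = (1 - \<delta>) * ?\<mu> (\<Union>z\<in>Z. cube s z)"
        using finZ s disjoint_family_cube
        by (subst measure_finite_Union) (auto simp: sum_distrib_left emeasure_cube)
      also have "\<dots> \<le> (1 - \<delta>) * ?\<mu> U"
        using \<delta> sub Uf s by (intro mult_left_mono measure_mono_fmeasurable) (auto intro!: sets.finite_UN finZ)
      also have "\<dots> \<le> (1 - \<delta>) * ((1 + \<delta>) * ?\<mu> K)" using \<mu>U \<delta> by (intro mult_left_mono) auto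
      also have "\<dots> = (1 - \<delta>\<^sup>2) * ?\<mu> K" by (simp add: power2_eq_square algebra_simps)
      also have "\<dots> < 1 * ?\<mu> K" using \<delta> K(2) by (intro mult_strict_right_mono) auto
      finally show False by simp
    qed
  qed
qed

lemma positive_measure_contains_compact:
  fixes E :: "(real ^ 'd) set"
  assumes E: "E \<in> sets borel" "0 < emeasure lborel E"
  obtains K where "compact K" "K \<subseteq> E" "0 < measure lborel K"
proof -
  have "\<exists>n. 0 < emeasure lborel (E \<inter> cball 0 (real n))"
  proof (rule ccontr)
    assume "\<not> ?thesis"
    then have "emeasure lborel (E \<inter> cball 0 (real n)) = 0" for n by (auto simp: zero_less_iff_neq_zero)
    then have "emeasure lborel (\<Union>n. E \<inter> cball 0 (real n)) = 0"
      using E by (intro emeasure_UN_eq_0) auto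
    moreover have "(\<Union>n. E \<inter> cball 0 (real n)) = E" using real_arch_simple by force
    ultimately show False using E by simp
  qed
  then obtain n where n: "0 < emeasure lborel (E \<inter> cball 0 (real n))" by blast
  define S where "S = E \<inter> cball 0 (real n)"
  have S: "S \<in> sets borel" using E by (simp add: S_def)
  have Sfin: "emeasure lborel S < \<infinity>"
    using emeasure_mono[of S "cball 0 (real n)" lborel] emeasure_lborel_cball_finite[of "0 :: real ^ 'd" "real n"]
    by (auto simp: S_def intro: le_less_trans)
  have pos: "0 < measure lborel S" using n Sfin by (auto simp: S_def[symmetric] measure_def enn2real_positive_iff)
  have "S \<in> sets lebesgue" using S by simp
  then obtain T where T: "closed T" "T \<subseteq> S" "S - T \<in> lmeasurable" "emeasure lebesgue (S - T) < ennreal (measure lborel S)"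
    using sets_lebesgue_inner_closed[OF _ pos] by blast
  have "compact T"
    using T by (intro compact_eq_bounded_closed[THEN iffD2] conjI bounded_subset[OF bounded_cball[of 0 "real n"]])
      (auto simp: S_def)
  moreover have "T \<subseteq> E" using T by (auto simp: S_def)
  moreover have "0 < measure lborel T"
  proof -
    have Tf: "T \<in> fmeasurable lborel" using \<open>compact T\<close> by (rule fmeasurable_compact)
    have Tb: "T \<in> sets borel" using T by simp
    have "emeasure lborel (S - T) < ennreal (measure lborel S)" using T(4) S Tb by simp
    moreover have "emeasure lborel S \<le> emeasure lborel (S - T) + emeasure lborel T"
      using emeasure_subadditive[of "S - T" lborel T] T(2) S Tb by (simp add: Un_absorb2)
    moreover have "emeasure lborel S = ennreal (measure lborel S)"
      using Sfin by (simp add: emeasure_eq_ennreal_measure)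
    ultimately have "emeasure lborel T \<noteq> 0" by auto
    then show ?thesis using emeasure_eq_measure2[OF Tf] by (simp add: zero_less_measure_iff)
  qed
  ultimately show thesis by (rule that)
qed

section \<open>Chernoff bounds for counts of sample points\<close>

context prob_space
begin

lemma expectation_exp_count:
  fixes S :: "'b measure"
  assumes indep: "indep_vars (\<lambda>_. S) X I" and I: "finite I" and C: "C \<in> sets S"
    and q: "\<And>i. i \<in> I \<Longrightarrow> prob (X i -` C \<inter> space M) = q"
  shows "integrable M (\<lambda>\<omega>. exp (t * real (card {i \<in> I. X i \<omega> \<in> C})))"
    and "expectation (\<lambda>\<omega>. exp (t * real (card {i \<in> I. X i \<omega> \<in> C}))) = (1 + q * (exp t - 1)) ^ card I"
proof -
  define g where "g x = 1 + (exp t - 1) * indicator C x" for x :: 'b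
  have g[measurable]: "g \<in> borel_measurable S" unfolding g_def using C by measurable
  have X[measurable]: "X i \<in> measurable M S" if "i \<in> I" for i
    using indep that by (auto simp: indep_vars_def)
  have ind: "indep_vars (\<lambda>_. borel) (\<lambda>i \<omega>. g (X i \<omega>)) I"
    using indep_vars_compose2[OF indep, of "\<lambda>_. g" "\<lambda>_. borel"] g by simp
  have Xind: "(\<lambda>\<omega>. g (X i \<omega>)) = (\<lambda>\<omega>. 1 + (exp t - 1) * indicator (X i -` C) \<omega>)" for i
    by (auto simp: g_def fun_eq_iff indicator_def)
  have integrable_ind: "integrable M (indicator (X i -` C) :: _ \<Rightarrow> real)" if "i \<in> I" for i
    using measurable_sets[OF X[OF that] C]
    by (subst integrable_indicator_iff) (auto simp: Int_commute less_top[symmetric])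
  have int: "integrable M (\<lambda>\<omega>. g (X i \<omega>))" if "i \<in> I" for i
    unfolding Xind using integrable_ind[OF that] by simp
  have expec: "expectation (\<lambda>\<omega>. g (X i \<omega>)) = 1 + q * (exp t - 1)" if "i \<in> I" for i
    unfolding Xind using integrable_ind[OF that] q[OF that]
    by (subst Bochner_Integration.integral_add) (auto simp: prob_space mult.commute intro!: integrable_mult_right)
  have eq: "exp (t * real (card {i \<in> I. X i \<omega> \<in> C})) = (\<Prod>i\<in>I. g (X i \<omega>))" for \<omega>
  proof -
    have "(\<Prod>i\<in>I. g (X i \<omega>)) = (\<Prod>i\<in>I. if X i \<omega> \<in> C then exp t else 1)"
      by (intro prod.cong) (auto simp: g_def)
    also have "\<dots> = exp t ^ card {i \<in> I. X i \<omega> \<in> C}"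
    proof -
      have "{i \<in> I. X i \<omega> \<in> C} = I \<inter> {i. X i \<omega> \<in> C}" by blast
      then show ?thesis using I by (simp add: prod.If_cases)
    qed
    finally show ?thesis by (simp add: exp_of_nat_mult[symmetric] mult.commute)
  qed
  show "integrable M (\<lambda>\<omega>. exp (t * real (card {i \<in> I. X i \<omega> \<in> C})))"
    unfolding eq by (rule indep_vars_integrable[OF I ind int])
  show "expectation (\<lambda>\<omega>. exp (t * real (card {i \<in> I. X i \<omega> \<in> C}))) = (1 + q * (exp t - 1)) ^ card I"
    unfolding eq by (subst indep_vars_lebesgue_integral[OF I ind int]) (simp_all add: expec)
qed

lemma sets_card_count:
  assumes "finite I" "\<And>i. i \<in> I \<Longrightarrow> X i \<in> measurable M S" "C \<in> sets S"
  shows "(\<lambda>\<omega>. real (card {i \<in> I. X i \<omega> \<in> C})) \<in> borel_measurable M"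
proof -
  have eq: "real (card {i \<in> I. X i \<omega> \<in> C}) = (\<Sum>i\<in>I. indicator C (X i \<omega>))" for \<omega>
  proof -
    have "{i \<in> I. X i \<omega> \<in> C} = I \<inter> {i. X i \<omega> \<in> C}" by blast
    then show ?thesis using assms(1) by (simp add: indicator_def sum.If_cases)
  qed
  show ?thesis unfolding eq using assms by measurable
qed

lemma one_plus_power_le_exp: "0 \<le> 1 + x \<Longrightarrow> (1 + x) ^ n \<le> exp (real n * (x::real))"
  using power_mono[of "1 + x" "exp x" n] exp_ge_add_one_self[of x] by (simp add: exp_of_nat_mult)

text \<open>
  Markov's inequality for \<open>exp (- u N)\<close> with \<open>u = \<epsilon> / 2\<close>; the exponent is
  \<open>m (exp (- u) - 1 + u (1 - \<epsilon>)) \<le> m (u\<^sup>2 - \<epsilon> u) = - m \<epsilon>\<^sup>2 / 4\<close>.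
\<close>

lemma chernoff_lower_tail:
  assumes indep: "indep_vars (\<lambda>_. S) X I" and I: "finite I" and C: "C \<in> sets S"
    and q: "\<And>i. i \<in> I \<Longrightarrow> prob (X i -` C \<inter> space M) = q"
    and m: "0 \<le> m" "m \<le> real (card I) * q" and \<epsilon>: "0 < \<epsilon>" "\<epsilon> \<le> 1" and ne: "I \<noteq> {}"
  shows "prob {\<omega> \<in> space M. real (card {i \<in> I. X i \<omega> \<in> C}) \<le> (1 - \<epsilon>) * m} \<le> exp (- (\<epsilon>\<^sup>2 / 4 * m))"
proof -
  define u where "u = \<epsilon> / 2"
  have u: "0 < u" "u \<le> 1" using \<epsilon> by (auto simp: u_def)
  let ?N = "\<lambda>\<omega>. real (card {i \<in> I. X i \<omega> \<in> C})"
  note E = expectation_exp_count[OF indep I C q, of "- u"]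
  have q01: "0 \<le> q" "q \<le> 1" using ne q by (metis ex_in_conv measure_nonneg, metis ex_in_conv prob_le_1)
  have "prob {\<omega> \<in> space M. ?N \<omega> \<le> (1 - \<epsilon>) * m}
      = prob {\<omega> \<in> space M. exp (- u * ?N \<omega>) \<ge> exp (- u * ((1 - \<epsilon>) * m))}"
    using u by simp
  also have "\<dots> \<le> expectation (\<lambda>\<omega>. exp (- u * ?N \<omega>)) / exp (- u * ((1 - \<epsilon>) * m))"
    by (rule integral_Markov_inequality_measure[where A = "space M" and u = "\<lambda>\<omega>. exp (- u * ?N \<omega>)", OF E(1)]) auto
  also have "\<dots> \<le> exp (- (m * (u - u\<^sup>2))) / exp (- u * ((1 - \<epsilon>) * m))"
  proof (intro divide_right_mono)
    have "exp (- u) \<le> 1 / (1 + u)"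
      using exp_ge_add_one_self[of u] u by (simp add: exp_minus field_simps)
    also have "\<dots> \<le> 1 - u + u\<^sup>2"
      using u by (simp add: field_simps power2_eq_square)
    finally have eu: "exp (- u) \<le> 1 - u + u\<^sup>2" .
    have "expectation (\<lambda>\<omega>. exp (- u * ?N \<omega>)) = (1 + q * (exp (- u) - 1)) ^ card I" by (rule E(2))
    also have "\<dots> \<le> exp (real (card I) * (q * (exp (- u) - 1)))"
    proof (rule one_plus_power_le_exp)
      have "q * (1 - exp (- u)) \<le> 1 * 1" using q01 u by (intro mult_mono) auto
      then show "0 \<le> 1 + q * (exp (- u) - 1)" by (simp add: algebra_simps)
    qed
    also have "real (card I) * (q * (exp (- u) - 1)) \<le> - (m * (u - u\<^sup>2))"
    proof -
      have "m * (u - u\<^sup>2) \<le> (real (card I) * q) * (1 - exp (- u))"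
        using eu m u q01 by (intro mult_mono) (auto simp: power2_eq_square mult_left_le)
      then show ?thesis by (simp add: algebra_simps)
    qed
    finally show "expectation (\<lambda>\<omega>. exp (- u * ?N \<omega>)) \<le> exp (- (m * (u - u\<^sup>2)))" by simp
  qed simp
  also have "\<dots> = exp (- (\<epsilon>\<^sup>2 / 4 * m))"
    by (simp add: exp_diff[symmetric] u_def power2_eq_square field_simps)
  finally show ?thesis .
qed

text \<open>
  A union bound over infinitely many cells. Markov's inequality is applied to \<open>exp (t N) - 1\<close> and not
  to \<open>exp (t N)\<close>: its expectation is at most a constant times the probability \<open>q j\<close> of the \<open>j\<close>-th cell,
  and these probabilities add up to at most \<open>1\<close>. The choice \<open>t = \<epsilon> / 2\<close> gives the exponent, and the
  hypothesis \<open>2 \<le> \<epsilon> m\<close> makes the subtraction of \<open>1\<close> cost only a factor \<open>2\<close>.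
\<close>

lemma chernoff_upper_tail_disjoint:
  fixes C :: "nat \<Rightarrow> 'b set"
  assumes indep: "indep_vars (\<lambda>_. S) X I" and I: "finite I" and C: "\<And>j. C j \<in> sets S"
    and q: "\<And>i j. i \<in> I \<Longrightarrow> prob (X i -` C j \<inter> space M) = q j"
    and disj: "disjoint_family C" and m: "\<And>j. real (card I) * q j \<le> m"
    and \<epsilon>: "0 < \<epsilon>" "\<epsilon> \<le> 1" and ne: "I \<noteq> {}" and large: "2 \<le> \<epsilon> * m"
  shows "prob {\<omega> \<in> space M. \<exists>j. (1 + \<epsilon>) * m \<le> real (card {i \<in> I. X i \<omega> \<in> C j})}
     \<le> 4 * real (card I) * exp (- (\<epsilon>\<^sup>2 / 4 * m))"
proof -
  define t where "t = \<epsilon> / 2"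
  have t: "0 < t" "t \<le> 1/2" using \<epsilon> by (auto simp: t_def)
  define N where "N j \<omega> = real (card {i \<in> I. X i \<omega> \<in> C j})" for j \<omega>
  have X: "X i \<in> measurable M S" if "i \<in> I" for i
    using indep that by (auto simp: indep_vars_def)
  have N[measurable]: "N j \<in> borel_measurable M" for j
    unfolding N_def using sets_card_count[OF I X C] by simp
  obtain i0 where i0: "i0 \<in> I" using ne by blast
  have q0: "0 \<le> q j" for j using q[OF i0, of j] measure_nonneg[of M] by metis
  have "(\<lambda>j. prob (X i0 -` C j \<inter> space M)) sums prob (\<Union>j. X i0 -` C j \<inter> space M)"
    using X[OF i0] C disj by (intro finite_measure_UNION)
      (auto simp: disjoint_family_on_def intro: measurable_sets)
  then have qsum: "summable q" "suminf q \<le> 1"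
    using q[OF i0] by (auto simp: sums_iff)
  define a where "a = (1 + \<epsilon>) * m"
  have m0: "0 < m" using large \<epsilon> by (metis less_le_trans zero_less_mult_pos zero_less_numeral)
  have "1 \<le> t * m" using large by (simp add: t_def)
  also have "\<dots> \<le> t * a" using m0 \<epsilon> t by (simp add: a_def)
  finally have ta: "1 \<le> t * a" .
  define Q where "Q = exp (t * a) - 1"
  have Q: "exp (t * a) / 2 \<le> Q" "0 < Q"
  proof -
    have "2 \<le> exp (t * a)" using exp_ge_add_one_self[of "t * a"] ta by linarith
    then show "exp (t * a) / 2 \<le> Q" "0 < Q" using ta by (simp_all add: Q_def)
  qed
  define B where "B = (exp t - 1) * exp (m * (exp t - 1)) / Q"
  have B0: "0 \<le> B" using t Q by (simp add: B_def)
  let ?A = "\<lambda>j. {\<omega> \<in> space M. a \<le> N j \<omega>}"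
  have A: "prob (?A j) \<le> real (card I) * q j * B" for j
  proof -
    note E = expectation_exp_count[OF indep I C q, of t j]
    have "prob (?A j) = prob {\<omega> \<in> space M. Q \<le> exp (t * N j \<omega>) - 1}"
      using t by (simp add: Q_def)
    also have "\<dots> \<le> expectation (\<lambda>\<omega>. exp (t * N j \<omega>) - 1) / Q"
      using E(1) t Q(2) by (intro integral_Markov_inequality_measure[where A = "space M"]) (auto simp: N_def)
    also have "expectation (\<lambda>\<omega>. exp (t * N j \<omega>) - 1) = (1 + q j * (exp t - 1)) ^ card I - 1"
      using E by (simp add: N_def prob_space)
    also have "\<dots> \<le> exp (real (card I) * q j * (exp t - 1)) - 1"
      using one_plus_power_le_exp[of "q j * (exp t - 1)" "card I"] q0[of j] t by (simp add: mult.assoc)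
    also have "\<dots> \<le> real (card I) * q j * (exp t - 1) * exp (m * (exp t - 1))"
    proof -
      define x where "x = real (card I) * q j * (exp t - 1)"
      have x: "0 \<le> x" "x \<le> m * (exp t - 1)" using q0[of j] t m[of j] by (auto simp: x_def intro!: mult_right_mono)
      \<comment> \<open>This gives \<open>exp x - 1 \<le> x exp x\<close>, which keeps the factor \<open>q j\<close> needed for the summation over \<open>j\<close>.\<close>
      have "exp x * (1 - x) \<le> exp x * exp (- x)"
        using exp_ge_add_one_self[of "- x"] by (intro mult_left_mono) auto
      then have "exp x - 1 \<le> x * exp x" by (simp add: exp_minus algebra_simps)
      also have "\<dots> \<le> x * exp (m * (exp t - 1))" using x by (intro mult_left_mono) auto
      finally show ?thesis by (simp add: x_def)
    qed
    finally show ?thesis using Q(2) by (simp add: B_def divide_right_mono mult.assoc)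
  qed
  have sm: "summable (\<lambda>j. real (card I) * q j * B)"
    using qsum(1) by (intro summable_mult summable_mult2)
  have smA: "summable (\<lambda>j. prob (?A j))"
    by (rule summable_comparison_test'[OF sm, of 0]) (use A in auto)
  have "prob (\<Union>j. ?A j) \<le> (\<Sum>j. prob (?A j))"
    by (intro finite_measure_subadditive_countably smA) auto
  also have "\<dots> \<le> (\<Sum>j. real (card I) * q j * B)" by (intro suminf_le A smA sm)
  also have "\<dots> = real (card I) * suminf q * B"
    using qsum(1) by (simp add: suminf_mult suminf_mult2[symmetric] summable_mult)
  also have "\<dots> \<le> real (card I) * 1 * B" using qsum(2) B0 by (intro mult_right_mono mult_left_mono) auto
  also have "\<dots> \<le> real (card I) * 1 * (4 * exp (- (\<epsilon>\<^sup>2 / 4 * m)))"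
  proof (intro mult_left_mono)
    have et: "exp t - 1 \<le> t + t\<^sup>2" using exp_bound[of t] t by simp
    also have "t + t\<^sup>2 \<le> 2" using t power_mono[of t "1/2" 2] by (simp add: power2_eq_square)
    finally have et2: "exp t - 1 \<le> 2" .
    have "B \<le> (exp t - 1) * exp (m * (exp t - 1)) / (exp (t * a) / 2)"
      unfolding B_def using Q t by (intro divide_left_mono) auto
    also have "\<dots> = (exp t - 1) * 2 * exp (m * (exp t - 1) - t * a)"
      by (simp add: exp_diff)
    also have "\<dots> \<le> 2 * 2 * exp (- (\<epsilon>\<^sup>2 / 4 * m))"
    proof (intro mult_mono)
      have "m * (exp t - 1) \<le> m * (t + t\<^sup>2)" using et m0 by (intro mult_left_mono) auto
      then have "m * (exp t - 1) - t * a \<le> m * (t + t\<^sup>2) - t * a" by simp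
      also have "\<dots> = - (\<epsilon>\<^sup>2 / 4 * m)" by (simp add: t_def a_def power2_eq_square algebra_simps)
      finally show "exp (m * (exp t - 1) - t * a) \<le> exp (- (\<epsilon>\<^sup>2 / 4 * m))" by simp
    qed (use et2 in auto)
    finally show "B \<le> 4 * exp (- (\<epsilon>\<^sup>2 / 4 * m))" by simp
  qed auto
  finally have "prob (\<Union>j. ?A j) \<le> 4 * real (card I) * exp (- (\<epsilon>\<^sup>2 / 4 * m))" by simp
  also have "(\<Union>j. ?A j) = {\<omega> \<in> space M. \<exists>j. (1 + \<epsilon>) * m \<le> real (card {i \<in> I. X i \<omega> \<in> C j})}"
    by (auto simp: a_def N_def)
  finally show ?thesis .
qed

text \<open>
  Since \<open>m n\<close> dominates every multiple of \<open>ln n\<close>, eventually \<open>exp (- c m n) \<le> n\<^sup>-\<^sup>3\<close>. The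
  probabilities are thus of order \<open>n\<^sup>-\<^sup>2\<close>, and the Borel-Cantelli lemma applies.
\<close>

lemma AE_eventually_of_exp_bound:
  assumes A: "\<And>n. A n \<in> sets M" and c: "0 < c"
    and bound: "eventually (\<lambda>n. prob (A n) \<le> \<kappa> * real n * exp (- (c * m n))) sequentially"
    and m: "filterlim (\<lambda>n. m n / ln (real n)) at_top sequentially"
  shows "AE \<omega> in M. eventually (\<lambda>n. \<omega> \<notin> A n) sequentially"
proof -
  have "eventually (\<lambda>n. 3 / c \<le> m n / ln (real n)) sequentially"
    using m by (simp add: filterlim_at_top)
  then have "eventually (\<lambda>n. norm (prob (A n)) \<le> \<bar>\<kappa>\<bar> * (1 / real n ^ 2)) sequentially"
    using bound eventually_ge_at_top[of 2]
  proof eventually_elim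
    case (elim n)
    have ln: "0 < ln (real n)" using elim by simp
    have "3 * ln (real n) \<le> c * m n" using elim(1) ln c by (simp add: field_simps)
    then have "exp (- (c * m n)) \<le> exp (- (3 * ln (real n)))" by simp
    also have "\<dots> = 1 / real n ^ 3"
      using elim exp_of_nat_mult[of 3 "ln (real n)"] by (simp add: exp_minus field_simps)
    finally have "real n * exp (- (c * m n)) \<le> real n * (1 / real n ^ 3)" by (intro mult_left_mono) auto
    also have "\<dots> = 1 / real n ^ 2" using elim by (simp add: power2_eq_square power3_eq_cube)
    finally have *: "real n * exp (- (c * m n)) \<le> 1 / real n ^ 2" .
    have "prob (A n) \<le> \<bar>\<kappa>\<bar> * (real n * exp (- (c * m n)))"
      using elim(2) mult_right_mono[OF abs_ge_self[of \<kappa>], of "real n * exp (- (c * m n))"]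
      by (simp add: mult.assoc)
    also have "\<dots> \<le> \<bar>\<kappa>\<bar> * (1 / real n ^ 2)" using * by (intro mult_left_mono) auto
    finally show ?case by simp
  qed
  moreover have "summable (\<lambda>n. \<bar>\<kappa>\<bar> * (1 / real n ^ 2))"
    using inverse_power_summable[of 2, where 'a=real] by (intro summable_mult) (simp add: field_simps)
  ultimately have "summable (\<lambda>n. prob (A n))" by (rule summable_comparison_test_ev)
  then have "AE \<omega> in M. eventually (\<lambda>n. \<omega> \<in> space M - A n) sequentially"
    using A by (intro borel_cantelli_AE1) (auto simp: less_top[symmetric])
  then show ?thesis by (rule AE_mp) (auto intro!: AE_I2 elim: eventually_mono)
qed

end

section \<open>Counts of an i.i.d. sample in small cubes\<close>

text \<open>
  The essential supremum of \<open>f\<close>; it is positive because a density does not vanish almost everywhere.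
\<close>

lemma exists_essential_upper_bound:
  fixes f :: "real ^ 'd \<Rightarrow> real"
  assumes f: "f \<in> borel_measurable borel" "\<And>x. 0 \<le> f x" "(\<integral>\<^sup>+ x. ennreal (f x) \<partial>lborel) = 1" "bounded (range f)"
  obtains F where "0 < F" "AE x in lborel. f x \<le> F" "\<And>h. h < F \<Longrightarrow> \<not> (AE x in lborel. f x \<le> h)"
proof -
  define S where "S = {h. AE x in lborel. f x \<le> h}"
  obtain B where B: "\<And>x. \<bar>f x\<bar> \<le> B" using f(4) by (auto simp: bounded_iff)
  have "B \<in> S" proof -
    have "f x \<le> B" for x using B[of x] by linarith
    then show ?thesis by (simp add: S_def)
  qed
  have pos: "0 < h" if "h \<in> S" for h
  proof (rule ccontr)
    assume "\<not> 0 < h"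
    with that have "AE x in lborel. ennreal (f x) = 0"
      unfolding S_def by (auto simp: ennreal_eq_0_iff)
    then have "(\<integral>\<^sup>+ x. ennreal (f x) \<partial>lborel) = (\<integral>\<^sup>+ (x :: real ^ 'd). 0 \<partial>lborel)"
      by (intro nn_integral_cong_AE) auto
    then show False using f(3) by simp
  qed
  have bdd: "bdd_below S" using pos by (auto intro!: bdd_belowI[of _ 0] less_imp_le)
  have "AE x in lborel. \<forall>n. f x \<le> Inf S + 1 / real (Suc n)"
    unfolding AE_all_countable
  proof
    fix n
    have "Inf S < Inf S + 1 / real (Suc n)" by simp
    then obtain h where "h \<in> S" "h < Inf S + 1 / real (Suc n)"
      using cInf_lessD[of S] \<open>B \<in> S\<close> by blast
    then show "AE x in lborel. f x \<le> Inf S + 1 / real (Suc n)"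
      unfolding S_def by auto
  qed
  then have le: "AE x in lborel. f x \<le> Inf S"
  proof (rule AE_mp, intro AE_I2 impI)
    fix x assume *: "\<forall>n. f x \<le> Inf S + 1 / real (Suc n)"
    show "f x \<le> Inf S"
    proof (rule field_le_epsilon)
      fix e :: real assume "0 < e"
      then obtain n where "1 / real (Suc n) < e" using nat_approx_posE by blast
      with spec[OF *, of n] show "f x \<le> Inf S + e" by linarith
    qed
  qed
  show thesis
  proof (rule that[of "Inf S", OF _ le])
    show "0 < Inf S" using pos le by (auto simp: S_def)
    fix h assume "h < Inf S"
    then show "\<not> (AE x in lborel. f x \<le> h)" using cInf_lower[OF _ bdd, of h] by (auto simp: S_def)
  qed
qed

text \<open>
  \<open>F\<close> is the essential supremum of the density, given by its two characteristic properties.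
\<close>

locale density_sample = prob_space M for M :: "'w measure" +
  fixes X :: "nat \<Rightarrow> 'w \<Rightarrow> real ^ 'd" and f :: "real ^ 'd \<Rightarrow> real" and F :: real
  assumes f_meas: "f \<in> borel_measurable borel"
    and indep: "indep_vars (\<lambda>_. borel) X {1..}"
    and density: "\<And>i. 1 \<le> i \<Longrightarrow> distributed M lborel (X i) (\<lambda>x. ennreal (f x))"
    and F_pos: "0 < F"
    and f_le: "AE x in lborel. f x \<le> F"
    and F_least: "\<And>h. h < F \<Longrightarrow> \<not> (AE x in lborel. f x \<le> h)"
begin

abbreviation sample :: "'w \<Rightarrow> nat \<Rightarrow> (real ^ 'd) set" where
  "sample \<omega> n \<equiv> (\<lambda>i. X i \<omega>) ` {1..n}"

text \<open>
  The common law of the sample points.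
\<close>

definition mass :: "(real ^ 'd) set \<Rightarrow> real" where
  "mass C = enn2real (\<integral>\<^sup>+ x. ennreal (f x) * indicator C x \<partial>lborel)"

lemma mass_nonneg: "0 \<le> mass C"
  by (simp add: mass_def)

lemma X_measurable: "1 \<le> i \<Longrightarrow> X i \<in> measurable M borel"
  using indep by (auto simp: indep_vars_def)

lemma prob_X_in:
  assumes "1 \<le> i" "C \<in> sets borel"
  shows "prob (X i -` C \<inter> space M) = mass C"
  using distributed_emeasure[OF density[OF assms(1)], of C] assms(2) by (simp add: measure_def mass_def)

lemma mass_finite:
  assumes "C \<in> sets borel"
  shows "(\<integral>\<^sup>+ x. ennreal (f x) * indicator C x \<partial>lborel) = ennreal (mass C)"
  using distributed_emeasure[OF density[of 1], of C] assms emeasure_finite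
  unfolding mass_def by (metis ennreal_enn2real infinity_ennreal_def less_top order_refl sets_lborel)

lemma mass_cube_le:
  assumes s: "0 < s"
  shows "mass (cube s z) \<le> F * s ^ CARD('d)"
proof -
  have "ennreal (mass (cube s z)) = (\<integral>\<^sup>+ x. ennreal (f x) * indicator (cube s z) x \<partial>lborel)"
    using s by (simp add: mass_finite)
  also have "\<dots> \<le> (\<integral>\<^sup>+ x. ennreal F * indicator (cube s z) x \<partial>lborel)"
    using f_le by (intro nn_integral_mono_AE) (auto elim!: eventually_mono intro!: mult_right_mono ennreal_leI)
  also have "\<dots> = ennreal (F * s ^ CARD('d))"
    using s F_pos by (simp add: nn_integral_cmult_indicator emeasure_cube ennreal_mult)
  finally show ?thesis using s F_pos by (simp add: mass_def[symmetric])
qed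

lemma mass_ge:
  assumes C: "C \<in> sets borel" and K: "K \<in> fmeasurable lborel" "K \<subseteq> C" and h: "0 \<le> h" "\<And>x. x \<in> K \<Longrightarrow> h \<le> f x"
  shows "h * measure lborel K \<le> mass C"
proof -
  have Kb: "K \<in> sets borel" using K(1) by (auto simp: fmeasurable_def)
  have "ennreal (h * measure lborel K) = (\<integral>\<^sup>+ x. ennreal h * indicator K x \<partial>lborel)"
    using K(1) Kb h(1) by (simp add: nn_integral_cmult_indicator emeasure_eq_measure2 ennreal_mult)
  also have "\<dots> \<le> (\<integral>\<^sup>+ x. ennreal (f x) * indicator C x \<partial>lborel)"
    using K(2) h(2) by (intro nn_integral_mono) (auto simp: indicator_def ennreal_leI)
  also have "\<dots> = ennreal (mass C)" by (rule mass_finite[OF C])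
  finally show ?thesis by (subst (asm) ennreal_le_iff) (simp add: mass_nonneg)
qed

text \<open>
  The vertex set of the graph is the set of sample points, so counting vertices amounts to counting
  indices only if the points are distinct. The diagonal is null for the product law of two points
  because that law has no atoms in either coordinate.
\<close>

lemma AE_sample_injective: "AE \<omega> in M. inj_on (\<lambda>i. X i \<omega>) {1..}"
proof -
  have ne: "AE \<omega> in M. X i \<omega> \<noteq> X j \<omega>" if ij: "1 \<le> i" "1 \<le> j" "i \<noteq> j" for i j
  proof -
    have "indep_var (PiM {i} (\<lambda>_. borel)) (\<lambda>\<omega>. restrict (\<lambda>k. X k \<omega>) {i})
                    (PiM {j} (\<lambda>_. borel)) (\<lambda>\<omega>. restrict (\<lambda>k. X k \<omega>) {j})"
      using ij by (intro indep_var_restrict[OF indep]) auto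
    then have "indep_var borel ((\<lambda>g. g i) \<circ> (\<lambda>\<omega>. restrict (\<lambda>k. X k \<omega>) {i}))
                    borel ((\<lambda>g. g j) \<circ> (\<lambda>\<omega>. restrict (\<lambda>k. X k \<omega>) {j}))"
      by (rule indep_var_compose) (rule measurable_component_singleton; simp)+
    then have "indep_var borel (X i) borel (X j)" by (simp add: comp_def)
    then have eq: "distr M borel (X i) \<Otimes>\<^sub>M distr M borel (X j)
        = distr M (borel \<Otimes>\<^sub>M borel) (\<lambda>\<omega>. (X i \<omega>, X j \<omega>))"
      by (simp add: indep_var_distribution_eq)
    note [measurable] = X_measurable[OF ij(1)] X_measurable[OF ij(2)]
    interpret j: prob_space "distr M borel (X j)" by (rule prob_space_distr) measurable
    let ?D = "{y. \<exists>x :: real ^ 'd. y = (x, x)}"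
    have D[measurable]: "?D \<in> sets (borel \<Otimes>\<^sub>M borel)"
      unfolding borel_prod by (intro borel_closed closed_diagonal)
    have null: "emeasure (distr M borel (X j)) {x} = 0" for x
    proof -
      have "emeasure (distr M borel (X j)) {x} = (\<integral>\<^sup>+ y. ennreal (f y) * indicator {x} y \<partial>lborel)"
        using distributed_emeasure[OF density[OF ij(2)], of "{x}"] by (simp add: emeasure_distr)
      also have "\<dots> = (\<integral>\<^sup>+ (y :: real ^ 'd). 0 \<partial>lborel)"
        using AE_lborel_singleton[of x] by (intro nn_integral_cong_AE) (auto elim!: eventually_mono)
      finally show ?thesis by simp
    qed
    have "emeasure (distr M borel (X i) \<Otimes>\<^sub>M distr M borel (X j)) ?D
       = (\<integral>\<^sup>+ x. emeasure (distr M borel (X j)) (Pair x -` ?D) \<partial>distr M borel (X i))"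
      by (rule j.emeasure_pair_measure_alt) (use D in simp)
    also have "(\<lambda>x. Pair x -` ?D) = (\<lambda>x. {x})" by auto
    finally have "emeasure (distr M (borel \<Otimes>\<^sub>M borel) (\<lambda>\<omega>. (X i \<omega>, X j \<omega>))) ?D = 0"
      using null by (simp add: eq)
    then have "emeasure M ((\<lambda>\<omega>. (X i \<omega>, X j \<omega>)) -` ?D \<inter> space M) = 0"
      by (subst (asm) emeasure_distr) auto
    moreover have "(\<lambda>\<omega>. (X i \<omega>, X j \<omega>)) -` ?D \<inter> space M \<in> sets M" by measurable
    ultimately have "(\<lambda>\<omega>. (X i \<omega>, X j \<omega>)) -` ?D \<inter> space M \<in> null_sets M" by auto
    then show ?thesis by (rule AE_I') auto
  qed
  have "AE \<omega> in M. \<forall>i. \<forall>j. 1 \<le> i \<and> 1 \<le> j \<and> i \<noteq> j \<longrightarrow> X i \<omega> \<noteq> X j \<omega>"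
    unfolding AE_all_countable using ne by auto
  then show ?thesis by (rule AE_mp) (auto simp: inj_on_def)
qed

text \<open>
  Every cell has mass at most \<open>F\<close> times its volume, hence the tail bound for disjoint cells applies
  to the whole grid at once.
\<close>

lemma AE_cube_counts_upper:
  assumes s: "eventually (\<lambda>n. 0 < s n) sequentially"
    and dense: "filterlim (\<lambda>n. real n * s n ^ CARD('d) / ln (real n)) at_top sequentially"
    and \<epsilon>: "0 < \<epsilon>" "\<epsilon> \<le> 1"
  shows "AE \<omega> in M. eventually (\<lambda>n. \<forall>z. real (card {i \<in> {1..n}. X i \<omega> \<in> cube (s n) z})
           < (1 + \<epsilon>) * (real n * F * s n ^ CARD('d))) sequentially"
proof -
  define m where "m n = real n * F * s n ^ CARD('d)" for n
  have m: "filterlim (\<lambda>n. m n / ln (real n)) at_top sequentially"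
    using filterlim_tendsto_pos_mult_at_top[OF tendsto_const F_pos dense] by (simp add: m_def field_simps)
  \<comment> \<open>The cells, enumerated by natural numbers and padded with empty sets.\<close>
  define C where "C n j = (if j \<in> range (to_nat :: ('d \<Rightarrow> int) \<Rightarrow> nat) then cube (s n) (from_nat j :: 'd \<Rightarrow> int) else {})" for n j
  have C_cube: "C n (to_nat z) = cube (s n) z" for n z by (simp add: C_def)
  have C_sets: "C n j \<in> sets borel" if "0 < s n" for n j using that by (simp add: C_def)
  have disj: "disjoint_family (C n)" for n
    unfolding disjoint_family_on_def
  proof (intro ballI impI)
    fix j j' :: nat assume "j \<noteq> j'"
    then show "C n j \<inter> C n j' = {}" by (auto simp: C_def cube_def fun_eq_iff)
  qed
  define good where "good n \<longleftrightarrow> 1 \<le> n \<and> 0 < s n \<and> 2 \<le> \<epsilon> * m n" for n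
  define A where "A n = (if good n then {\<omega> \<in> space M. \<exists>j. (1 + \<epsilon>) * m n \<le> real (card {i \<in> {1..n}. X i \<omega> \<in> C n j})} else {})" for n
  have A_sets: "A n \<in> sets M" for n
  proof (cases "good n")
    case True
    define N where "N j \<omega> = real (card {i \<in> {1..n}. X i \<omega> \<in> C n j})" for j \<omega>
    have N: "N j \<in> borel_measurable M" for j
      unfolding N_def using True
      by (intro sets_card_count[where S = borel] X_measurable C_sets) (simp_all add: good_def)
    have "{\<omega> \<in> space M. \<exists>j. (1 + \<epsilon>) * m n \<le> N j \<omega>} \<in> sets M"
      by (rule sets.sets_Collect_countable_Ex) (rule borel_measurable_le[OF borel_measurable_const N])
    moreover have "A n = {\<omega> \<in> space M. \<exists>j. (1 + \<epsilon>) * m n \<le> N j \<omega>}"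
      unfolding A_def N_def using True by (rule if_P)
    ultimately show ?thesis by (simp only:)
  qed (simp add: A_def)
  have "eventually (\<lambda>n. 2 / \<epsilon> \<le> m n / ln (real n)) sequentially"
    using m by (simp add: filterlim_at_top)
  moreover have "eventually (\<lambda>n. 1 \<le> ln (real n)) sequentially"
    using filterlim_compose[OF ln_at_top filterlim_real_sequentially] by (simp add: filterlim_at_top)
  ultimately have good: "eventually good sequentially"
    using s eventually_ge_at_top[of 1]
  proof eventually_elim
    case (elim n)
    have "2 / \<epsilon> * 1 \<le> 2 / \<epsilon> * ln (real n)" using elim(2) \<epsilon> by (intro mult_left_mono) auto
    also have "\<dots> \<le> m n" using elim(1,2) by (simp add: field_simps)
    finally have "2 \<le> \<epsilon> * m n" using \<epsilon> by (simp add: field_simps)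
    then show ?case using elim by (simp add: good_def)
  qed
  have "AE \<omega> in M. eventually (\<lambda>n. \<omega> \<notin> A n) sequentially"
  proof (rule AE_eventually_of_exp_bound[OF A_sets _ _ m, where \<kappa> = 4 and c = "\<epsilon>\<^sup>2 / 4"])
    show "0 < \<epsilon>\<^sup>2 / 4" using \<epsilon> by simp
    show "eventually (\<lambda>n. prob (A n) \<le> 4 * real n * exp (- (\<epsilon>\<^sup>2 / 4 * m n))) sequentially"
      using good
    proof eventually_elim
      case (elim n)
      then have g: "1 \<le> n" "0 < s n" "2 \<le> \<epsilon> * m n" by (auto simp: good_def)
      have "0 \<le> m n" using F_pos g by (simp add: m_def)
      have "prob {\<omega> \<in> space M. \<exists>j. (1 + \<epsilon>) * m n \<le> real (card {i \<in> {1..n}. X i \<omega> \<in> C n j})}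
        \<le> 4 * real (card {1..n}) * exp (- (\<epsilon>\<^sup>2 / 4 * m n))"
      proof (rule chernoff_upper_tail_disjoint[where S = borel and q = "\<lambda>j. mass (C n j)"])
        show "indep_vars (\<lambda>_. borel) X {1..n}" by (rule indep_vars_subset[OF indep]) auto
        show "prob (X i -` C n j \<inter> space M) = mass (C n j)" if "i \<in> {1..n}" for i j
          using that C_sets g by (intro prob_X_in) auto
        show "real (card {1..n}) * mass (C n j) \<le> m n" for j
        proof (cases "j \<in> range (to_nat :: ('d \<Rightarrow> int) \<Rightarrow> nat)")
          case True
          then show ?thesis using mass_cube_le[OF g(2), of "from_nat j"] g(1)
            by (auto simp: C_def m_def mult.assoc)
        next
          case False
          then show ?thesis using \<open>0 \<le> m n\<close> by (simp add: C_def mass_def)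
        qed
      qed (use g \<epsilon> disj C_sets in auto)
      with elim show ?case by (simp add: A_def)
    qed
  qed
  then show ?thesis
  proof (rule AE_mp, intro AE_I2 impI)
    fix \<omega> assume \<omega>: "\<omega> \<in> space M" "eventually (\<lambda>n. \<omega> \<notin> A n) sequentially"
    from \<omega>(2) good show "eventually (\<lambda>n. \<forall>z. real (card {i \<in> {1..n}. X i \<omega> \<in> cube (s n) z})
           < (1 + \<epsilon>) * (real n * F * s n ^ CARD('d))) sequentially"
    proof eventually_elim
      case (elim n)
      show ?case
      proof
        fix z :: "'d \<Rightarrow> int"
        from elim \<omega>(1) have "\<not> (1 + \<epsilon>) * m n \<le> real (card {i \<in> {1..n}. X i \<omega> \<in> C n (to_nat z)})"
          by (auto simp: A_def)
        then show "real (card {i \<in> {1..n}. X i \<omega> \<in> cube (s n) z}) < (1 + \<epsilon>) * (real n * F * s n ^ CARD('d))"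
          unfolding C_cube m_def by simp
      qed
    qed
  qed
qed

text \<open>
  Only boundedly many cells are considered for each \<open>n\<close>, so a plain union bound suffices here. The cells
  may depend on \<open>n\<close> but not on the sample.
\<close>

lemma AE_counts_lower:
  fixes C :: "nat \<Rightarrow> 'z \<Rightarrow> (real ^ 'd) set" and Z :: "nat \<Rightarrow> 'z set" and \<kappa> :: nat
  assumes Z: "\<And>n. finite (Z n)" "\<And>n. card (Z n) \<le> \<kappa>"
    and C: "eventually (\<lambda>n. \<forall>z\<in>Z n. C n z \<in> sets borel \<and> m n \<le> real n * mass (C n z)) sequentially"
    and m: "filterlim (\<lambda>n. m n / ln (real n)) at_top sequentially"
    and \<epsilon>: "0 < \<epsilon>" "\<epsilon> \<le> 1"
  shows "AE \<omega> in M. eventually (\<lambda>n. \<forall>z\<in>Z n. (1 - \<epsilon>) * m n < real (card {i \<in> {1..n}. X i \<omega> \<in> C n z})) sequentially"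
proof -
  define good where "good n \<longleftrightarrow> 1 \<le> n \<and> 0 \<le> m n \<and> (\<forall>z\<in>Z n. C n z \<in> sets borel \<and> m n \<le> real n * mass (C n z))" for n
  define A' where "A' n z = {\<omega> \<in> space M. real (card {i \<in> {1..n}. X i \<omega> \<in> C n z}) \<le> (1 - \<epsilon>) * m n}" for n z
  define A where "A n = (if good n then (\<Union>z\<in>Z n. A' n z) else {})" for n
  have A'_sets: "A' n z \<in> sets M" if "good n" "z \<in> Z n" for n z
  proof -
    define N where "N \<omega> = real (card {i \<in> {1..n}. X i \<omega> \<in> C n z})" for \<omega>
    have N: "N \<in> borel_measurable M"
      unfolding N_def using that
      by (intro sets_card_count[where S = borel] X_measurable) (simp_all add: good_def)
    have "{\<omega> \<in> space M. N \<omega> \<le> (1 - \<epsilon>) * m n} \<in> sets M"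
      by (rule borel_measurable_le[OF N borel_measurable_const])
    then show ?thesis unfolding A'_def N_def .
  qed
  have A_sets: "A n \<in> sets M" for n using A'_sets Z by (auto simp: A_def intro!: sets.finite_UN)
  have "eventually (\<lambda>n. 0 \<le> m n / ln (real n)) sequentially" using m by (simp add: filterlim_at_top)
  then have good: "eventually good sequentially"
    using C eventually_ge_at_top[of 2]
  proof eventually_elim
    case (elim n)
    have "0 < ln (real n)" using elim by simp
    then show ?case using elim by (simp add: good_def zero_le_divide_iff)
  qed
  have "AE \<omega> in M. eventually (\<lambda>n. \<omega> \<notin> A n) sequentially"
  proof (rule AE_eventually_of_exp_bound[OF A_sets _ _ m, where \<kappa> = \<kappa> and c = "\<epsilon>\<^sup>2 / 4"])
    show "0 < \<epsilon>\<^sup>2 / 4" using \<epsilon> by simp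
    show "eventually (\<lambda>n. prob (A n) \<le> real \<kappa> * real n * exp (- (\<epsilon>\<^sup>2 / 4 * m n))) sequentially"
      using good
    proof eventually_elim
      case (elim n)
      then have g: "1 \<le> n" "0 \<le> m n" "\<And>z. z \<in> Z n \<Longrightarrow> C n z \<in> sets borel"
        "\<And>z. z \<in> Z n \<Longrightarrow> m n \<le> real n * mass (C n z)" by (auto simp: good_def)
      have one: "prob (A' n z) \<le> exp (- (\<epsilon>\<^sup>2 / 4 * m n))" if z: "z \<in> Z n" for z
        unfolding A'_def
      proof (rule chernoff_lower_tail[where S = borel and q = "mass (C n z)"])
        show "indep_vars (\<lambda>_. borel) X {1..n}" by (rule indep_vars_subset[OF indep]) auto
        show "prob (X i -` C n z \<inter> space M) = mass (C n z)" if "i \<in> {1..n}" for i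
          using that z g by (intro prob_X_in) auto
      qed (use g z \<epsilon> in auto)
      have "prob (A n) \<le> (\<Sum>z\<in>Z n. prob (A' n z))"
        using elim A'_sets Z by (auto simp: A_def intro!: finite_measure_subadditive_finite)
      also have "\<dots> \<le> real (card (Z n)) * exp (- (\<epsilon>\<^sup>2 / 4 * m n))"
        using sum_mono[OF one, of "Z n"] by simp
      also have "\<dots> \<le> (real \<kappa> * real n) * exp (- (\<epsilon>\<^sup>2 / 4 * m n))"
      proof (rule mult_right_mono)
        have "real (card (Z n)) * 1 \<le> real \<kappa> * real n" using Z(2)[of n] g(1) by (intro mult_mono) auto
        then show "real (card (Z n)) \<le> real \<kappa> * real n" by simp
      qed simp
      finally show ?case .
    qed
  qed
  then show ?thesis
  proof (rule AE_mp, intro AE_I2 impI)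
    fix \<omega> assume \<omega>: "\<omega> \<in> space M" "eventually (\<lambda>n. \<omega> \<notin> A n) sequentially"
    from \<omega>(2) good show "eventually (\<lambda>n. \<forall>z\<in>Z n. (1 - \<epsilon>) * m n < real (card {i \<in> {1..n}. X i \<omega> \<in> C n z})) sequentially"
    proof eventually_elim
      case (elim n)
      then show ?case using \<omega>(1) by (auto simp: A_def A'_def not_le)
    qed
  qed
qed

end

section \<open>Almost sure bounds for the chromatic numbers\<close>

lemma mem_cube_subdivide:
  assumes T: "0 < (T::nat)"
  shows "y \<in> cube (real T * s) b \<longleftrightarrow> (\<forall>i. \<lfloor>y $ i / s\<rfloor> div int T = b i)"
proof -
  have "\<lfloor>y $ i / (real T * s)\<rfloor> = \<lfloor>y $ i / s\<rfloor> div int T" for i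
    using floor_divide_real_eq_div[of "int T" "y $ i / s"] by (simp add: mult.commute)
  then show ?thesis by (simp add: cube_def)
qed

lemma card_subcubes:
  assumes T: "0 < (T::nat)"
  shows "finite {z :: 'd::finite \<Rightarrow> int. \<forall>i. z i div int T = b i}"
    and "card {z :: 'd::finite \<Rightarrow> int. \<forall>i. z i div int T = b i} = T ^ CARD('d)"
proof -
  have "x div int T = c \<longleftrightarrow> x \<in> {int T * c..<int T * c + int T}" for x c
  proof
    assume c: "x div int T = c"
    have "int T * c + x mod int T = x" "x mod int T < int T" "0 \<le> x mod int T"
      using T mult_div_mod_eq[of "int T" x] by (simp_all add: c)
    then show "x \<in> {int T * c..<int T * c + int T}" unfolding atLeastLessThan_iff by linarith
  next
    assume "x \<in> {int T * c..<int T * c + int T}"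
    then show "x div int T = c" using int_div_pos_eq[of x "int T" c "x - int T * c"] by auto
  qed
  then have eq: "{z :: 'd \<Rightarrow> int. \<forall>i. z i div int T = b i} = PiE UNIV (\<lambda>i. {int T * b i..<int T * b i + int T})"
    by (auto simp: PiE_def)
  show "finite {z :: 'd \<Rightarrow> int. \<forall>i. z i div int T = b i}"
    unfolding eq by (intro finite_PiE) auto
  show "card {z :: 'd \<Rightarrow> int. \<forall>i. z i div int T = b i} = T ^ CARD('d)"
    unfolding eq by (simp add: card_PiE)
qed

context density_sample
begin

text \<open>
  The number of colours from \<open>chromatic_number_upper\<close>, with cells of side \<open>\<rho> / D\<close> and at most
  \<open>(1 + 1 / D) n F (\<rho> / D)\<^sup>d\<close> points in each, is \<open>g D \<cdot> n F \<rho>\<^sup>d\<close> plus a constant coming from rounding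
  up the number of rounds; \<open>g D\<close> tends to \<open>(L + 1)\<^sup>d / \<bar>A\<bar>\<close>.
\<close>

lemma AE_chromatic_number_upper:
  fixes A :: "(real ^ 'd) set"
  assumes p: "1 \<le> p" and A: "packing p L A" "0 < card A"
    and c: "(real L + 1) ^ CARD('d) / real (card A) < c"
    and \<rho>: "eventually (\<lambda>n. 0 < \<rho> n) sequentially"
    and dense: "filterlim (\<lambda>n. real n * \<rho> n ^ CARD('d) / ln (real n)) at_top sequentially"
  shows "AE \<omega> in M. eventually (\<lambda>n. real (chromatic_number (geometric_graph p (sample \<omega> n) (\<rho> n)))
           \<le> c * (real n * F * \<rho> n ^ CARD('d))) sequentially"
proof -
  let ?d = "CARD('d)"
  define k where "k = card A"
  define P where "P D = nat \<lceil>(real L + 1) * (real D + 2 * real ?d)\<rceil>" for D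
  define g where "g D = (1 + 1 / real D) * (((real L + 1) * (real D + 2 * real ?d) + 1) / real D) ^ ?d / real k" for D
  have k: "0 < k" using A by (simp add: k_def)
  have base: "(\<lambda>D. ((real L + 1) * (real D + 2 * real ?d) + 1) / real D) \<longlonglongrightarrow> real L + 1"
    by real_asymp
  have "g \<longlonglongrightarrow> (1 + 0) * (real L + 1) ^ ?d / real k"
    unfolding g_def by (intro tendsto_intros base lim_1_over_n) (use k in auto)
  then have "eventually (\<lambda>D. g D < c) sequentially"
    using c by (intro order_tendstoD) (auto simp: k_def)
  then have "eventually (\<lambda>D. g D < c \<and> 1 \<le> D) sequentially"
    using eventually_ge_at_top by (rule eventually_conj)
  from eventually_happens'[OF sequentially_bot this]
  obtain D where D: "g D < c" "1 \<le> D" by blast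
  define \<epsilon> where "\<epsilon> = 1 / real D"
  have \<epsilon>: "0 < \<epsilon>" "\<epsilon> \<le> 1" using D by (auto simp: \<epsilon>_def)
  define s where "s n = \<rho> n / real D" for n
  define m where "m n = real n * F * \<rho> n ^ ?d" for n
  have s_pos: "eventually (\<lambda>n. 0 < s n) sequentially"
    using \<rho> by eventually_elim (use D in \<open>simp add: s_def\<close>)
  have "filterlim (\<lambda>n. (1 / real D) ^ ?d * (real n * \<rho> n ^ ?d / ln (real n))) at_top sequentially"
    using D by (intro filterlim_tendsto_pos_mult_at_top[OF tendsto_const _ dense]) auto
  then have s_dense: "filterlim (\<lambda>n. real n * s n ^ ?d / ln (real n)) at_top sequentially"
    by (simp add: s_def power_divide field_simps)
  have "filterlim (\<lambda>n. F * (real n * \<rho> n ^ ?d / ln (real n))) at_top sequentially"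
    by (intro filterlim_tendsto_pos_mult_at_top[OF tendsto_const F_pos dense])
  then have m_dense: "filterlim (\<lambda>n. m n / ln (real n)) at_top sequentially"
    by (simp add: m_def field_simps)
  have "filterlim (\<lambda>n. m n / ln (real n) * ln (real n)) at_top sequentially"
    by (intro filterlim_at_top_mult_at_top[OF m_dense] filterlim_compose[OF ln_at_top filterlim_real_sequentially])
  then have "eventually (\<lambda>n. real (P D) ^ ?d / (c - g D) \<le> m n / ln (real n) * ln (real n)) sequentially"
    by (simp add: filterlim_at_top)
  then have m_large: "eventually (\<lambda>n. real (P D) ^ ?d \<le> (c - g D) * m n) sequentially"
    using eventually_ge_at_top[of 2] by eventually_elim (use D in \<open>simp add: field_simps\<close>)
  from AE_cube_counts_upper[OF s_pos s_dense \<epsilon>] show ?thesis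
  proof (rule AE_mp, intro AE_I2 impI)
    fix \<omega> assume "eventually (\<lambda>n. \<forall>z. real (card {i \<in> {1..n}. X i \<omega> \<in> cube (s n) z})
           < (1 + \<epsilon>) * (real n * F * s n ^ ?d)) sequentially"
    from this m_large \<rho>
    show "eventually (\<lambda>n. real (chromatic_number (geometric_graph p (sample \<omega> n) (\<rho> n)))
           \<le> c * (real n * F * \<rho> n ^ ?d)) sequentially"
    proof eventually_elim
      case (elim n)
      define b where "b = nat \<lfloor>(1 + \<epsilon>) * (real n * F * s n ^ ?d)\<rfloor>"
      have pos: "0 \<le> (1 + \<epsilon>) * (real n * F * s n ^ ?d)"
        using \<epsilon> F_pos elim(3) D by (simp add: s_def)
      have cell: "card (sample \<omega> n \<inter> cube (\<rho> n / real D) z) \<le> b" for z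
      proof -
        have "sample \<omega> n \<inter> cube (\<rho> n / real D) z \<subseteq> (\<lambda>i. X i \<omega>) ` {i \<in> {1..n}. X i \<omega> \<in> cube (s n) z}"
          by (auto simp: s_def)
        then have "card (sample \<omega> n \<inter> cube (\<rho> n / real D) z) \<le> card {i \<in> {1..n}. X i \<omega> \<in> cube (s n) z}"
          by (intro surj_card_le) auto
        moreover have "real (card {i \<in> {1..n}. X i \<omega> \<in> cube (s n) z}) < (1 + \<epsilon>) * (real n * F * s n ^ ?d)"
          using elim(1) by blast
        ultimately show ?thesis unfolding b_def using pos by linarith
      qed
      have "chromatic_number (geometric_graph p (sample \<omega> n) (\<rho> n)) \<le> (b div k + 1) * P D ^ ?d"
        using chromatic_number_upper[OF p _ elim(3) _ A cell] D unfolding k_def P_def by simp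
      then have "real (chromatic_number (geometric_graph p (sample \<omega> n) (\<rho> n))) \<le> real ((b div k + 1) * P D ^ ?d)"
        by (rule of_nat_mono)
      also have "\<dots> = real (b div k) * real (P D) ^ ?d + real (P D) ^ ?d" by (simp add: algebra_simps)
      also have "real (b div k) * real (P D) ^ ?d \<le> g D * m n"
      proof -
        have "real (b div k) \<le> real b / real k" by (rule of_nat_div_le_of_nat)
        also have "\<dots> \<le> (1 + \<epsilon>) * (real n * F * s n ^ ?d) / real k"
          unfolding b_def using pos by (intro divide_right_mono) auto
        finally have 1: "real (b div k) \<le> (1 + \<epsilon>) * (real n * F * s n ^ ?d) / real k" .
        have 2: "real (P D) \<le> (real L + 1) * (real D + 2 * real ?d) + 1"
          unfolding P_def by (simp add: le_of_int_ceiling ceiling_correct)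
        have "real (b div k) * real (P D) ^ ?d
           \<le> (1 + \<epsilon>) * (real n * F * s n ^ ?d) / real k * ((real L + 1) * (real D + 2 * real ?d) + 1) ^ ?d"
          using 1 2 pos by (intro mult_mono power_mono) auto
        also have "\<dots> = g D * m n"
          using D k by (simp add: g_def m_def s_def \<epsilon>_def power_divide)
        finally show ?thesis .
      qed
      also have "g D * m n + real (P D) ^ ?d \<le> c * m n" using elim(2) by (simp add: algebra_simps)
      finally show ?case by (simp add: m_def)
    qed
  qed
qed

text \<open>
  One parameter \<open>\<theta> < 1\<close> controls all losses. A cube of side \<open>L t\<close> with \<open>t = \<theta> l r\<close> is chosen such
  that \<open>f > \<theta> F\<close> outside a tiny proportion \<open>\<delta>\<close> of it. It is cut into \<open>T\<^sup>d\<close> cells of side \<open>s\<close>, and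
  \<open>\<delta>\<close> is so small that even a single cell has mass at least \<open>\<theta>\<^sup>2 F s\<^sup>d\<close>; another factor \<open>\<theta>\<close> is lost
  to random fluctuations. Thus every cell contains a sample point, which gives the density that
  \<open>card_cube_le_distant_chromatic_number\<close> requires, and the counts add up to
  \<open>\<theta>\<^sup>3 n F (L t)\<^sup>d\<close>, which explains the power \<open>3 + d\<close> of \<open>\<theta>\<close>.
\<close>

lemma AE_distant_chromatic_number_lower:
  assumes p: "1 \<le> p" and l: "1 \<le> l" and L: "1 \<le> L"
    and K: "\<forall>A :: (real ^ 'd) set. packing p L A \<longrightarrow> card A \<le> K" "0 < K"
    and c: "c < real L ^ CARD('d) / real K"
    and r: "eventually (\<lambda>n. 0 < r n) sequentially" "r \<longlonglongrightarrow> 0"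
    and dense: "filterlim (\<lambda>n. real n * r n ^ CARD('d) / ln (real n)) at_top sequentially"
  shows "AE \<omega> in M. eventually (\<lambda>n. c * (real n * F * (real l * r n) ^ CARD('d))
           \<le> real (distant_chromatic_number l (geometric_graph p (sample \<omega> n) (r n)))) sequentially"
proof -
  let ?d = "CARD('d)"
  have "((\<lambda>\<theta>. \<theta> ^ (3 + ?d) * real L ^ ?d / real K) \<longlongrightarrow> 1 ^ (3 + ?d) * real L ^ ?d / real K) (at_left 1)"
    using K by (intro tendsto_intros) auto
  then have "eventually (\<lambda>\<theta>. c < \<theta> ^ (3 + ?d) * real L ^ ?d / real K) (at_left 1)"
    using c by (intro order_tendstoD(1)) auto
  moreover have "eventually (\<lambda>\<theta>. 0 < \<theta> \<and> \<theta> < 1) (at_left (1::real))"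
    using eventually_at_left_real[of 0 "1::real"] by (auto elim: eventually_mono)
  ultimately have "eventually (\<lambda>\<theta>. c < \<theta> ^ (3 + ?d) * real L ^ ?d / real K \<and> 0 < \<theta> \<and> \<theta> < 1) (at_left (1::real))"
    by eventually_elim auto
  from eventually_happens'[OF _ this]
  obtain \<theta> where \<theta>: "c < \<theta> ^ (3 + ?d) * real L ^ ?d / real K" "0 < \<theta>" "\<theta> < 1" by auto
  \<comment> \<open>\<open>T\<close> is so large that the diameter of a cell is at most \<open>\<eta> = (1 - \<theta>) r / 2\<close>.\<close>
  define T where "T = nat \<lceil>2 * real ?d * real L * real l / (1 - \<theta>)\<rceil> + 1"
  have T: "0 < T" "2 * real ?d * real L * real l / (1 - \<theta>) \<le> real T" unfolding T_def by linarith+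
  define t where "t n = \<theta> * real l * r n" for n
  define s where "s n = real L * t n / real T" for n
  define \<eta> where "\<eta> n = (1 - \<theta>) / 2 * r n" for n
  have Ts: "real T * s n = real L * t n" for n using T by (simp add: s_def)
  have L\<theta>l: "0 < real L * \<theta> * real l" using L \<theta> l by simp
  have s_eq: "s n = real L * \<theta> * real l / real T * r n" for n by (simp add: s_def t_def)

  define E where "E = {x. \<theta> * F < f x}"
  have E: "E \<in> sets borel" unfolding E_def using f_meas borel_measurable_iff_greater[of f borel] by simp
  have "\<not> (AE x in lborel. f x \<le> \<theta> * F)" using \<theta> F_pos by (intro F_least) simp
  then have "emeasure lborel E \<noteq> 0"
    using AE_iff_measurable[of E lborel "\<lambda>x. f x \<le> \<theta> * F"] E by (simp add: E_def not_le)
  then have Epos: "0 < emeasure lborel E" by (simp only: zero_less_iff_neq_zero not_False_eq_True)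
  obtain Q where Q: "compact Q" "Q \<subseteq> E" "0 < measure lborel Q"
    by (rule positive_measure_contains_compact[OF E Epos])
  \<comment> \<open>Even if the whole exceptional part of the cube falls into one cell, it takes at most the
    proportion \<open>1 - \<theta>\<close> of that cell.\<close>
  define \<delta> where "\<delta> = (1 - \<theta>) / real T ^ ?d"
  have Td: "1 \<le> real T ^ ?d" using T(1) by (intro one_le_power) simp
  have \<delta>: "0 < \<delta>" unfolding \<delta>_def using \<theta> Td by (intro divide_pos_pos) linarith+
  have \<delta>1: "\<delta> < 1" unfolding \<delta>_def using \<theta> Td by (subst pos_divide_less_eq) linarith+
  obtain s0 where s0: "0 < s0"
    "\<And>s. 0 < s \<Longrightarrow> s < s0 \<Longrightarrow> \<exists>z. measure lborel (cube s z - Q) \<le> \<delta> * s ^ ?d"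
    by (rule compact_almost_fills_small_cube[OF Q(1,3) \<delta> \<delta>1]) blast
  define b where "b n = (SOME z. measure lborel (cube (real T * s n) z - Q) \<le> \<delta> * (real T * s n) ^ ?d)" for n
  define Z where "Z n = {z. \<forall>i. z i div int T = b n i}" for n
  define m where "m n = real n * F * \<theta>\<^sup>2 * s n ^ ?d" for n

  have "real T * s n = (real L * \<theta> * real l) * r n" for n using T by (simp add: s_eq)
  then have "(\<lambda>n. real T * s n) \<longlonglongrightarrow> 0" using tendsto_mult_right_zero[OF r(2)] by simp
  then have "eventually (\<lambda>n. real T * s n < s0) sequentially" using s0 by (intro order_tendstoD) auto
  then have b: "eventually (\<lambda>n. measure lborel (cube (real T * s n) (b n) - Q) \<le> \<delta> * (real T * s n) ^ ?d) sequentially"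
    using r(1)
  proof eventually_elim
    case (elim n)
    then have "0 < real T * s n" using L\<theta>l T by (simp add: s_eq)
    from s0(2)[OF this elim(1)] show ?case unfolding b_def by (rule someI_ex)
  qed
  have s_pos: "eventually (\<lambda>n. 0 < s n) sequentially"
    using r(1) by eventually_elim (use L\<theta>l T in \<open>simp add: s_eq\<close>)
  define \<kappa> where "\<kappa> = real L * \<theta> * real l / real T"
  have "filterlim (\<lambda>n. F * \<theta>\<^sup>2 * \<kappa> ^ ?d * (real n * r n ^ ?d / ln (real n))) at_top sequentially"
    using L\<theta>l T \<theta> F_pos
    by (intro filterlim_tendsto_pos_mult_at_top[OF tendsto_const _ dense]) (simp add: \<kappa>_def)
  moreover have "m n / ln (real n) = F * \<theta>\<^sup>2 * \<kappa> ^ ?d * (real n * r n ^ ?d / ln (real n))" for n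
    unfolding m_def s_eq \<kappa>_def[symmetric] power_mult_distrib by simp
  ultimately have m_dense: "filterlim (\<lambda>n. m n / ln (real n)) at_top sequentially" by (simp only:)
  have cells: "eventually (\<lambda>n. \<forall>z\<in>Z n. cube (s n) z \<in> sets borel \<and> m n \<le> real n * mass (cube (s n) z)) sequentially"
    using b s_pos
  proof eventually_elim
    case (elim n)
    show ?case
    proof (intro ballI conjI)
      fix z assume z: "z \<in> Z n"
      show cb: "cube (s n) z \<in> sets borel" using elim by (intro sets_cube) auto
      have sub: "cube (s n) z \<subseteq> cube (real T * s n) (b n)"
        using z unfolding mem_cube_subdivide[OF T(1)] subset_iff by (auto simp: Z_def cube_def)
      have Qb: "Q \<in> sets borel" using Q(1) by (simp add: compact_imp_closed)
      have Ts_pos: "0 < real T * s n" using T elim by simp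
      have "measure lborel (cube (s n) z - Q) \<le> measure lborel (cube (real T * s n) (b n) - Q)"
        using sub cb Qb fmeasurable_cube[OF Ts_pos, of "b n"]
        by (intro measure_mono_fmeasurable) (auto intro!: fmeasurable_Diff)
      also have "\<dots> \<le> (1 - \<theta>) * s n ^ ?d"
        using elim(1) T by (simp add: \<delta>_def power_mult_distrib)
      finally have "measure lborel (cube (s n) z - Q) \<le> (1 - \<theta>) * s n ^ ?d" .
      moreover have "measure lborel (cube (s n) z)
          \<le> measure lborel (cube (s n) z \<inter> Q) + measure lborel (cube (s n) z - Q)"
        using measure_Un_le[of "cube (s n) z \<inter> Q" lborel "cube (s n) z - Q"] cb Qb
        by (simp add: Int_Diff_Un)
      ultimately have "\<theta> * s n ^ ?d \<le> measure lborel (cube (s n) z \<inter> Q)"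
        using measure_cube[OF elim(2), of z] by (simp add: algebra_simps)
      then have "\<theta> * F * (\<theta> * s n ^ ?d) \<le> \<theta> * F * measure lborel (cube (s n) z \<inter> Q)"
        using \<theta> F_pos by (intro mult_left_mono) auto
      also have "\<dots> \<le> mass (cube (s n) z)"
      proof (rule mass_ge[OF cb])
        show "cube (s n) z \<inter> Q \<in> fmeasurable lborel"
          using fmeasurable_cube[OF elim(2), of z] Qb by (auto intro: fmeasurable_Int_fmeasurable)
      qed (use Q(2) \<theta> F_pos in \<open>auto simp: E_def less_imp_le\<close>)
      finally have "real n * (\<theta> * F * (\<theta> * s n ^ ?d)) \<le> real n * mass (cube (s n) z)"
        by (intro mult_left_mono) auto
      then show "m n \<le> real n * mass (cube (s n) z)" by (simp add: m_def power2_eq_square ac_simps)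
    qed
  qed
  have Z: "finite (Z n)" "card (Z n) = T ^ ?d" for n
    unfolding Z_def using card_subcubes[OF T(1)] by auto
  have "AE \<omega> in M. eventually (\<lambda>n. \<forall>z\<in>Z n. (1 - (1 - \<theta>)) * m n < real (card {i \<in> {1..n}. X i \<omega> \<in> cube (s n) z})) sequentially"
    using Z \<theta> by (intro AE_counts_lower[OF _ _ cells m_dense, where \<kappa> = "T ^ ?d"]) auto
  then show ?thesis using AE_sample_injective
  proof eventually_elim
    case (elim \<omega>)
    from elim(1) r(1) s_pos show ?case
    proof eventually_elim
      case (elim n)
      let ?V = "sample \<omega> n" and ?\<chi> = "distant_chromatic_number l (geometric_graph p (sample \<omega> n) (r n))"
      have m0: "0 \<le> \<theta> * m n" using F_pos \<theta> elim by (simp add: m_def)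
      have cnt: "\<theta> * m n < real (card (?V \<inter> cube (s n) z))" if "z \<in> Z n" for z
      proof -
        have "?V \<inter> cube (s n) z = (\<lambda>i. X i \<omega>) ` {i \<in> {1..n}. X i \<omega> \<in> cube (s n) z}" by auto
        moreover have "inj_on (\<lambda>i. X i \<omega>) {i \<in> {1..n}. X i \<omega> \<in> cube (s n) z}"
          by (rule inj_on_subset[OF \<open>inj_on (\<lambda>i. X i \<omega>) {1..}\<close>]) auto
        ultimately have "card (?V \<inter> cube (s n) z) = card {i \<in> {1..n}. X i \<omega> \<in> cube (s n) z}"
          by (simp add: card_image)
        then show ?thesis using elim(1) that by auto
      qed
      have subcell: "(\<lambda>i. \<lfloor>y $ i / s n\<rfloor>) \<in> Z n" if "y \<in> cube (real L * t n) (b n)" for y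
        using that mem_cube_subdivide[OF T(1), of y "s n" "b n"] unfolding Ts Z_def by simp
      have near: "\<exists>v\<in>?V. lp_norm p (y - v) \<le> \<eta> n" if y: "y \<in> cube (real L * t n) (b n)" for y
      proof -
        define z where "z = (\<lambda>i. \<lfloor>y $ i / s n\<rfloor>)"
        have "0 < real (card (?V \<inter> cube (s n) z))" using cnt[OF subcell[OF y]] m0 by (simp add: z_def)
        then obtain v where v: "v \<in> ?V" "v \<in> cube (s n) z" by (auto simp: card_gt_0_iff)
        have "lp_norm p (y - v) \<le> real ?d * s n"
        proof (rule lp_norm_le[OF p])
          fix i
          have "y \<in> cube (s n) z" unfolding z_def by (rule mem_cube_floor)
          then show "\<bar>(y - v) $ i\<bar> \<le> s n" by (rule cube_component_diff[OF elim(3) _ v(2)])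
        qed
        also have "\<dots> = (real ?d * real L * real l) * \<theta> / real T * r n" by (simp add: s_eq)
        also have "\<dots> \<le> (1 - \<theta>) / 2 * r n"
        proof (rule mult_right_mono)
          have "(real ?d * real L * real l) * \<theta> \<le> (real ?d * real L * real l) * 1"
            using \<theta> by (intro mult_left_mono) auto
          also have "\<dots> \<le> (1 - \<theta>) / 2 * real T" using T(2) \<theta> by (simp add: field_simps)
          finally show "(real ?d * real L * real l) * \<theta> / real T \<le> (1 - \<theta>) / 2"
            using T(1) by (simp add: field_simps)
        qed (use elim in simp)
        finally show ?thesis using v(1) by (auto simp: \<eta>_def)
      qed
      have few: "card (?V \<inter> cube (real L * t n) (b n)) \<le> K * ?\<chi>"
      proof (rule card_cube_le_distant_chromatic_number[OF p _ l, where \<eta> = "\<eta> n"])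
        show "0 \<le> \<eta> n" "0 < t n" using \<theta> l elim by (simp_all add: \<eta>_def t_def)
        show "t n + 2 * real l * \<eta> n \<le> real l * r n" by (simp add: t_def \<eta>_def field_simps)
      qed (use L near K in auto)
      have many: "real (card (?V \<inter> cube (real L * t n) (b n))) \<ge> real T ^ ?d * (\<theta> * m n)"
      proof -
        have "?V \<inter> cube (real L * t n) (b n) = (\<Union>z\<in>Z n. ?V \<inter> cube (s n) z)"
          using subcell mem_cube_floor mem_cube_subdivide[OF T(1), where s = "s n" and b = "b n"]
          unfolding Ts by (fastforce simp: Z_def cube_def)
        moreover have "card (\<Union>z\<in>Z n. ?V \<inter> cube (s n) z) = (\<Sum>z\<in>Z n. card (?V \<inter> cube (s n) z))"
          using Z by (intro card_UN_disjoint) (auto simp: cube_def)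
        moreover have "(\<Sum>z\<in>Z n. \<theta> * m n) \<le> (\<Sum>z\<in>Z n. real (card (?V \<inter> cube (s n) z)))"
          using cnt by (intro sum_mono less_imp_le) auto
        ultimately show ?thesis using Z by simp
      qed
      have "real T ^ ?d * (\<theta> * m n) \<le> real K * real ?\<chi>"
        using many of_nat_mono[OF few, where 'a = real] unfolding of_nat_mult by (rule order_trans)
      moreover have "real T ^ ?d * (\<theta> * m n) = \<theta> ^ (3 + ?d) * real L ^ ?d * (real n * F * (real l * r n) ^ ?d)"
        using T unfolding m_def s_eq power_mult_distrib power_divide power_add
        by (simp add: power2_eq_square power3_eq_cube)
      ultimately have "\<theta> ^ (3 + ?d) * real L ^ ?d / real K * (real n * F * (real l * r n) ^ ?d) \<le> real ?\<chi>"
        using K(2) by (simp add: field_simps)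
      moreover have "c * (real n * F * (real l * r n) ^ ?d)
         \<le> \<theta> ^ (3 + ?d) * real L ^ ?d / real K * (real n * F * (real l * r n) ^ ?d)"
        using \<theta>(1) F_pos elim by (intro mult_right_mono) auto
      ultimately show ?case by linarith
    qed
  qed
qed

text \<open>
  With \<open>u = (L + 1)\<^sup>d / K\<close> and \<open>v = L\<^sup>d / K\<close>, the slack \<open>u / v < a\<close> is split evenly between the upper
  bound \<open>u \<beta>\<close> and the lower bound \<open>v / \<beta>\<close>. The lower bound for \<open>\<chi>\<close> is the one for \<open>\<chi>\<^sub>1 \<le> \<chi>\<close>.
\<close>

lemma AE_chromatic_ratio_between:
  assumes p: "1 \<le> p" and l: "1 \<le> l" and a: "1 < a"
    and r: "eventually (\<lambda>n. 0 < r n) sequentially" "r \<longlonglongrightarrow> 0"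
    and dense: "filterlim (\<lambda>n. real n * r n ^ CARD('d) / ln (real n)) at_top sequentially"
  shows "AE \<omega> in M. eventually (\<lambda>n.
      real (distant_chromatic_number l (geometric_graph p (sample \<omega> n) (r n))) /
        (real l ^ CARD('d) * real (chromatic_number (geometric_graph p (sample \<omega> n) (r n)))) \<in> {1 / a..a}) sequentially"
proof -
  let ?d = "CARD('d)"
  have "(\<lambda>L. ((real L + 1) / real L) ^ ?d) \<longlonglongrightarrow> 1 ^ ?d"
    by (intro tendsto_power) real_asymp
  then have "eventually (\<lambda>L. ((real L + 1) / real L) ^ ?d < a \<and> 1 \<le> L) sequentially"
    using a by (intro eventually_conj order_tendstoD eventually_ge_at_top) auto
  from eventually_happens'[OF sequentially_bot this]
  obtain L where L: "((real L + 1) / real L) ^ ?d < a" "1 \<le> L" by blast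
  obtain A :: "(real ^ 'd) set" where A: "packing p L A" "0 < card A"
    "\<forall>B :: (real ^ 'd) set. packing p L B \<longrightarrow> card B \<le> card A"
    using packing_maximum[OF p] by metis
  define u where "u = (real L + 1) ^ ?d / real (card A)"
  define v where "v = real L ^ ?d / real (card A)"
  define \<beta> where "\<beta> = sqrt (a / (u / v))"
  have uv: "0 < u" "0 < v" "u / v < a"
    using L A(2) by (auto simp: u_def v_def power_divide add_pos_nonneg)
  then have \<beta>: "1 < \<beta>" "\<beta> * \<beta> = a / (u / v)" by (auto simp: \<beta>_def divide_simps)
  have ratio: "u * \<beta> = a * (v / \<beta>)" using uv \<beta> by (simp add: field_simps)
  have c: "u < u * \<beta>" "v / \<beta> < v" "0 < v / \<beta>" "0 < u * \<beta>" using uv \<beta> by (auto simp: field_simps)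
  have lr: "eventually (\<lambda>n. 0 < real l * r n) sequentially" using r(1) by eventually_elim (use l in simp)
  have "filterlim (\<lambda>n. real l ^ ?d * (real n * r n ^ ?d / ln (real n))) at_top sequentially"
    using l by (intro filterlim_tendsto_pos_mult_at_top[OF tendsto_const _ dense]) auto
  then have ldense: "filterlim (\<lambda>n. real n * (real l * r n) ^ ?d / ln (real n)) at_top sequentially"
    by (simp add: power_mult_distrib ac_simps)
  note up1 = AE_chromatic_number_upper[OF p A(1,2) c(1)[unfolded u_def] r(1) dense, folded u_def]
  note upl = AE_chromatic_number_upper[OF p A(1,2) c(1)[unfolded u_def] lr ldense, folded u_def]
  note lo1 = AE_distant_chromatic_number_lower[OF p order_refl L(2) A(3,2) c(2)[unfolded v_def] r dense, folded v_def]
  note lol = AE_distant_chromatic_number_lower[OF p l L(2) A(3,2) c(2)[unfolded v_def] r dense, folded v_def]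
  from up1 upl lo1 lol show ?thesis
  proof eventually_elim
    case (elim \<omega>)
    from elim r(1) eventually_ge_at_top[of 1] show ?case
    proof eventually_elim
      case (elim n)
      let ?G = "geometric_graph p (sample \<omega> n) (r n)"
      define m where "m = real n * F * r n ^ ?d"
      have m: "0 < m" using elim F_pos by (simp add: m_def)
      have lm: "real n * F * (real l * r n) ^ ?d = real l ^ ?d * m" by (simp add: m_def power_mult_distrib)
      have ld: "0 < real l ^ ?d" using l by simp
      have "distant_chromatic_number 1 ?G \<le> chromatic_number ?G"
        using distant_chromatic_number_le[OF p _ elim(5), of "sample \<omega> n" 1] by simp
      then have lo: "v / \<beta> * m \<le> real (chromatic_number ?G)"
        using elim(3) by (simp add: m_def)
      then have \<chi>: "0 < real (chromatic_number ?G)" using c m by (meson less_le_trans mult_pos_pos)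
      have up: "real (chromatic_number ?G) \<le> u * \<beta> * m" using elim(1) by (simp add: m_def)
      have "distant_chromatic_number l ?G \<le> chromatic_number (geometric_graph p (sample \<omega> n) (real l * r n))"
        by (rule distant_chromatic_number_le[OF p _ elim(5)]) simp
      then have upd: "real (distant_chromatic_number l ?G) \<le> u * \<beta> * (real l ^ ?d * m)"
        using elim(2) unfolding lm by linarith
      have lod: "v / \<beta> * (real l ^ ?d * m) \<le> real (distant_chromatic_number l ?G)"
        using elim(4) unfolding lm .
      have den: "0 < real l ^ ?d * real (chromatic_number ?G)" using ld \<chi> by simp
      have "real (distant_chromatic_number l ?G) \<le> a * (real l ^ ?d * real (chromatic_number ?G))"
      proof -
        have "u * \<beta> * (real l ^ ?d * m) = a * real l ^ ?d * (v / \<beta> * m)" unfolding ratio by (simp add: ac_simps)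
        also have "\<dots> \<le> a * real l ^ ?d * real (chromatic_number ?G)"
          using lo a ld by (intro mult_left_mono) auto
        finally show ?thesis using upd by (simp add: ac_simps)
      qed
      moreover have "real l ^ ?d * real (chromatic_number ?G) \<le> a * real (distant_chromatic_number l ?G)"
      proof -
        have "real l ^ ?d * real (chromatic_number ?G) \<le> real l ^ ?d * (u * \<beta> * m)"
          using up ld by (intro mult_left_mono) auto
        also have "\<dots> = a * (v / \<beta> * (real l ^ ?d * m))" unfolding ratio by (simp add: ac_simps)
        also have "\<dots> \<le> a * real (distant_chromatic_number l ?G)"
          using lod a by (intro mult_left_mono) auto
        finally show ?thesis .
      qed
      ultimately show ?case using den a by (simp add: field_simps)
    qed
  qed
qed

lemma AE_chromatic_ratio_tendsto_1:
  assumes p: "1 \<le> p" and l: "1 \<le> l"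
    and r: "eventually (\<lambda>n. 0 < r n) sequentially" "r \<longlonglongrightarrow> 0"
    and dense: "filterlim (\<lambda>n. real n * r n ^ CARD('d) / ln (real n)) at_top sequentially"
  shows "AE \<omega> in M. (\<lambda>n.
      real (distant_chromatic_number l (geometric_graph p (sample \<omega> n) (r n))) /
        (real l ^ CARD('d) * real (chromatic_number (geometric_graph p (sample \<omega> n) (r n))))) \<longlonglongrightarrow> 1"
proof -
  define R where "R \<omega> n = real (distant_chromatic_number l (geometric_graph p (sample \<omega> n) (r n))) /
        (real l ^ CARD('d) * real (chromatic_number (geometric_graph p (sample \<omega> n) (r n))))" for \<omega> n
  have "AE \<omega> in M. \<forall>k. eventually (\<lambda>n. R \<omega> n \<in> {1 / (1 + 1 / real (Suc k))..1 + 1 / real (Suc k)}) sequentially"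
    unfolding AE_all_countable R_def
    by (intro allI AE_chromatic_ratio_between[OF p l _ r dense]) simp
  then have "AE \<omega> in M. R \<omega> \<longlonglongrightarrow> 1"
  proof (rule AE_mp, intro AE_I2 impI)
    fix \<omega> assume *: "\<forall>k. eventually (\<lambda>n. R \<omega> n \<in> {1 / (1 + 1 / real (Suc k))..1 + 1 / real (Suc k)}) sequentially"
    show "R \<omega> \<longlonglongrightarrow> 1"
    proof (rule tendstoI)
      fix e :: real assume "0 < e"
      then obtain k where k: "1 / real (Suc k) < e" using nat_approx_posE by blast
      define x where "x = 1 / real (Suc k)"
      have x: "0 < x" "x < e" using k by (auto simp: x_def)
      have "1 - x \<le> 1 / (1 + x)" using x by (simp add: field_simps)
      then show "eventually (\<lambda>n. dist (R \<omega> n) 1 < e) sequentially"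
        using spec[OF *, of k] x unfolding x_def[symmetric]
        by (auto elim!: eventually_mono simp: dist_real_def abs_if)
    qed
  qed
  then show ?thesis unfolding R_def .
qed

end

theorem theorem2:
  fixes M :: "'w measure"
    and X :: "nat \<Rightarrow> 'w \<Rightarrow> real ^ 'd"
    and f :: "real ^ 'd \<Rightarrow> real"
    and r :: "nat \<Rightarrow> real"
    and p :: ereal
    and l :: nat
    and G :: "nat \<Rightarrow> 'w \<Rightarrow> (real ^ 'd) pair_pre_digraph"
  assumes prob: "prob_space M"
    and p: "1 \<le> p"
    and f_measurable: "f \<in> borel_measurable borel"
    and f_nonneg: "\<And>x. 0 \<le> f x"
    and f_integral: "(\<integral>\<^sup>+ x. ennreal (f x) \<partial>lborel) = 1"
    and f_bounded: "bounded (range f)"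
    and X_indep: "prob_space.indep_vars M (\<lambda>_. borel) X {1..}"
    and X_density: "\<And>i. 1 \<le> i \<Longrightarrow> distributed M lborel (X i) (\<lambda>x. ennreal (f x))"
    and r_pos: "\<And>n. 1 \<le> n \<Longrightarrow> 0 < r n"
    and r_null: "r \<longlonglongrightarrow> 0"
    and G: "\<And>n \<omega>. G n \<omega> = geometric_graph p ((\<lambda>i. X i \<omega>) ` {1..n}) (r n)"
    and l: "1 \<le> l"
    and dense: "filterlim (\<lambda>n. real n * r n ^ CARD('d) / ln (real n)) at_top sequentially"
    and f_cond:
      "((AE x in lborel. isCont f x) \<and>
        \<not> (\<exists>s :: nat \<Rightarrow> real ^ 'd. (\<forall>k. s k isolated_in support f) \<and>
              (\<exists>x\<in>support f. x islimpt range s)))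
       \<or> ess_inf_density M (X 1) f > 0"
  shows "AE \<omega> in M.
           (\<lambda>n. real (distant_chromatic_number l (G n \<omega>)) /
                (real l ^ CARD('d) * real (chromatic_number (G n \<omega>)))) \<longlonglongrightarrow> 1"
proof -
  interpret prob_space M by (rule prob)
  obtain F where F: "0 < F" "AE x in lborel. f x \<le> F" "\<And>h. h < F \<Longrightarrow> \<not> (AE x in lborel. f x \<le> h)"
    using exists_essential_upper_bound[OF f_measurable f_nonneg f_integral f_bounded] by blast
  interpret density_sample M X f F
    by unfold_locales (use f_measurable X_indep X_density F in auto)
  have "eventually (\<lambda>n. 0 < r n) sequentially"
    using eventually_ge_at_top[of 1] by eventually_elim (rule r_pos)
  from AE_chromatic_ratio_tendsto_1[OF p l this r_null dense] show ?thesis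
    unfolding G .
qed

end
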